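(* If $G$ is a $(1,3)$-critical graph, then $14|V(G)| - 9|E(G)| \le -6$.
   Context: Graphs are finite and simple. A graph $G$ is $(1,3)$-colorable if its vertex set can be partitioned into two (possibly empty) subsets $V_1$ and $V_2$ such that every vertex of the induced subgraph $G[V_1]$ has degree at most $1$ in $G[V_1]$, and every vertex of $G[V_2]$ has degree at most $3$ in $G[V_2]$. A graph $G$ is $(1,3)$-critical if $G$ is not $(1,3)$-colorable, but every proper subgraph of $G$ is $(1,3)$-colorable. *)

theory Defs
  imports Main
begin

(* A graph is a pair (V, E); edges are two-element sets of vertices. *)
type_synonym 'a graph = "'a set \<times> 'a set set"

abbreviation verts :: "'a graph \<Rightarrow> 'a set" where
  "verts G \<equiv> fst G"

abbreviation edges :: "'a graph \<Rightarrow> 'a set set" where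
  "edges G \<equiv> snd G"

definition simple_graph :: "'a graph \<Rightarrow> bool" where
  "simple_graph G \<longleftrightarrow> finite (verts G) \<and> (\<forall>e\<in>edges G. e \<subseteq> verts G \<and> card e = 2)"

definition degree :: "'a graph \<Rightarrow> 'a \<Rightarrow> nat" where
  "degree G v = card {e \<in> edges G. v \<in> e}"

definition induced_subgraph :: "'a graph \<Rightarrow> 'a set \<Rightarrow> 'a graph" where
  "induced_subgraph G S = (S, {e \<in> edges G. e \<subseteq> S})"

definition subgraph :: "'a graph \<Rightarrow> 'a graph \<Rightarrow> bool" where
  "subgraph H G \<longleftrightarrow> simple_graph H \<and> verts H \<subseteq> verts G \<and> edges H \<subseteq> edges G"

definition proper_subgraph :: "'a graph \<Rightarrow> 'a graph \<Rightarrow> bool" where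
  "proper_subgraph H G \<longleftrightarrow> subgraph H G \<and> H \<noteq> G"

definition colorable :: "nat \<Rightarrow> nat \<Rightarrow> 'a graph \<Rightarrow> bool" where
  "colorable i j G \<longleftrightarrow> (\<exists>V1 V2. V1 \<union> V2 = verts G \<and> V1 \<inter> V2 = {} \<and>
     (\<forall>v\<in>V1. degree (induced_subgraph G V1) v \<le> i) \<and>
     (\<forall>v\<in>V2. degree (induced_subgraph G V2) v \<le> j))"

definition critical :: "nat \<Rightarrow> nat \<Rightarrow> 'a graph \<Rightarrow> bool" where
  "critical i j G \<longleftrightarrow> \<not> colorable i j G \<and> (\<forall>H. proper_subgraph H G \<longrightarrow> colorable i j H)"

end

theory Submission imports Defs begin

text \<open>
  Give every vertex \<open>v\<close> its own capacities \<open>a v \<in> {-1, 0, 1}\<close> and \<open>b v \<in> {-1, \<dots>, 3}\<close> for the two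
  colours, and let the potential of a vertex set be the sum of the weights \<open>1 + 4 a v + 3 max (b v) 0\<close>
  minus 9 for every edge inside. The claim for critical graphs follows from a stronger one: a set
  that cannot be coloured either contains a set that cannot be coloured and has potential at most
  \<open>-6\<close>, or it contains an explicit star-shaped obstruction formed by vertices with \<open>b v = -1\<close>.

  In a counterexample \<open>V\<close> with fewest vertices, colouring a proper subset first and lowering the
  capacities outside it shows that proper subsets have potential at least \<open>-1\<close>, and at least \<open>0\<close>
  when they miss two vertices. Such a gap allows capacities to be lowered by one at selected
  vertices as well, which excludes vertices of too small degree; here vertices of degree 2 with full
  capacities (links) play a special role. Now the potential of \<open>V\<close> is distributed over the vertices
  that are not links. All of them get a nonpositive charge, and at most one of them has more than
  \<open>b v\<close> neighbours that are not links. Giving this vertex and all links colour \<open>True\<close>, and all others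
  colour \<open>False\<close>, is then a colouring of \<open>V\<close>.
\<close>

section \<open>Potentials and colourings with capacities\<close>

text \<open>With prescribed capacities the problem reproduces itself: once a set \<open>S\<close> is
  coloured, the rest is an instance of the same problem in which every colour seen in
  \<open>S\<close> is forbidden. The constants fit this step. Forbidding \<open>True\<close> costs
  at most 8 and forbidding \<open>False\<close> at most 9 in weight, while the responsible edge
  carries 9, so nothing is lost and each forbidden \<open>True\<close> even saves 1; full capacities
  weigh 1 + 4 + 9 = 14. Without the truncation \<open>max (b v) 0\<close>, forbidding
  \<open>False\<close> could cost 12. The price of the truncation is that a vertex restricted to
  \<open>True\<close> weighs as much as one with \<open>b v = 0\<close>. A star of such vertices can
  therefore be uncolourable with potential -3. This is the one obstruction that the bound -6 does
  not see, and much of the work goes into excluding it. In the discharging, degree counting alone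
  leaves a positive charge on some vertices with \<open>a u = 1\<close> and at most one neighbour
  that is not a link. Those configurations are why tight numbers of links need separate
  arguments.\<close>

lemma sum_card_fibres:
  assumes "finite E" "finite W"
  shows "(\<Sum>r\<in>W. int (card {v \<in> E. f v = r})) = int (card {v \<in> E. f v \<in> W})"
proof -
  have "card (\<Union>r\<in>W. {v \<in> E. f v = r}) = (\<Sum>r\<in>W. card {v \<in> E. f v = r})"
    using assms by (intro card_UN_disjoint) auto
  moreover have "(\<Union>r\<in>W. {v \<in> E. f v = r}) = {v \<in> E. f v \<in> W}" by blast
  ultimately show ?thesis by simp
qed

definition wt :: "int \<Rightarrow> int \<Rightarrow> int" where
  "wt i j = 1 + 4 * i + 3 * max j 0"

locale adjacency =
  fixes adj :: "'a \<Rightarrow> 'a \<Rightarrow> bool"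
  assumes adj_sym: "adj x y \<Longrightarrow> adj y x"
    and adj_irrefl: "\<not> adj x x"
begin

definition nb :: "'a set \<Rightarrow> 'a \<Rightarrow> 'a set" where
  "nb S x = {y \<in> S. adj x y}"

definition edges_in :: "'a set \<Rightarrow> 'a set set" where
  "edges_in S = {e. \<exists>x\<in>S. \<exists>y\<in>S. adj x y \<and> e = {x, y}}"

definition pot :: "('a \<Rightarrow> int) \<Rightarrow> ('a \<Rightarrow> int) \<Rightarrow> 'a set \<Rightarrow> int" where
  "pot a b S = (\<Sum>v\<in>S. wt (a v) (b v)) - 9 * int (card (edges_in S))"

text \<open>The colours \<open>True\<close> and \<open>False\<close> stand for \<open>V\<^sub>1\<close> and \<open>V\<^sub>2\<close>, with capacities \<open>a\<close> and \<open>b\<close>;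
  the capacity \<open>-1\<close> forbids a colour.\<close>

definition cap :: "('a \<Rightarrow> int) \<Rightarrow> ('a \<Rightarrow> int) \<Rightarrow> bool \<Rightarrow> 'a \<Rightarrow> int" where
  "cap a b i v = (if i then a v else b v)"

definition cdeg :: "'a set \<Rightarrow> ('a \<Rightarrow> bool) \<Rightarrow> 'a \<Rightarrow> int" where
  "cdeg S \<phi> v = int (card {r \<in> nb S v. \<phi> r = \<phi> v})"

definition valid :: "('a \<Rightarrow> int) \<Rightarrow> ('a \<Rightarrow> int) \<Rightarrow> 'a set \<Rightarrow> ('a \<Rightarrow> bool) \<Rightarrow> bool" where
  "valid a b S \<phi> \<longleftrightarrow> (\<forall>v\<in>S. cdeg S \<phi> v \<le> cap a b (\<phi> v) v)"

definition col :: "('a \<Rightarrow> int) \<Rightarrow> ('a \<Rightarrow> int) \<Rightarrow> 'a set \<Rightarrow> bool" where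
  "col a b S \<longleftrightarrow> (\<exists>\<phi>. valid a b S \<phi>)"

text \<open>Too many vertices that can only have colour \<open>True\<close> around one of them: such a set is not
  colourable although its potential can be large.\<close>

definition overfull :: "('a \<Rightarrow> int) \<Rightarrow> ('a \<Rightarrow> int) \<Rightarrow> 'a set \<Rightarrow> bool" where
  "overfull a b S \<longleftrightarrow> (\<exists>v\<in>S. b v = -1 \<and> a v + 1 \<le> int (card {r \<in> nb S v. b r = -1}))"

definition bounded_caps :: "('a \<Rightarrow> int) \<Rightarrow> ('a \<Rightarrow> int) \<Rightarrow> 'a set \<Rightarrow> bool" where
  "bounded_caps a b S \<longleftrightarrow> (\<forall>v\<in>S. -1 \<le> a v \<and> a v \<le> 1 \<and> -1 \<le> b v \<and> b v \<le> 3)"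

section \<open>Neighbourhoods, edge counts and potentials of unions\<close>

lemma finite_nb [simp]: "finite S \<Longrightarrow> finite (nb S x)"
  by (simp add: nb_def)

lemma nb_mono: "S \<subseteq> T \<Longrightarrow> nb S x \<subseteq> nb T x"
  by (auto simp: nb_def)

lemma nb_Un: "nb (S \<union> T) x = nb S x \<union> nb T x"
  by (auto simp: nb_def)

lemma nb_empty [simp]: "nb {} x = {}"
  by (simp add: nb_def)

lemma nb_insert_self [simp]: "nb (insert x S) x = nb S x"
  by (auto simp: nb_def adj_irrefl)

lemma finite_edges_in: "finite S \<Longrightarrow> finite (edges_in S)"
  by (rule finite_subset[of _ "Pow S"]) (auto simp: edges_in_def)

lemma card_edges_in_insert:
  assumes "finite S" "x \<notin> S"
  shows "card (edges_in (insert x S)) = card (edges_in S) + card (nb S x)"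
proof -
  have "edges_in (insert x S) = edges_in S \<union> (\<lambda>y. {x, y}) ` nb S x"
    by (auto simp: edges_in_def nb_def adj_irrefl insert_commute dest: adj_sym)
  moreover have "edges_in S \<inter> (\<lambda>y. {x, y}) ` nb S x = {}"
    using assms by (auto simp: edges_in_def nb_def doubleton_eq_iff)
  moreover have "inj_on (\<lambda>y. {x, y}) (nb S x)"
    by (auto simp: inj_on_def doubleton_eq_iff)
  ultimately show ?thesis
    using assms by (simp add: card_Un_disjoint finite_edges_in card_image)
qed

lemma sum_card_nb:
  assumes "finite S" "finite W"
  shows "(\<Sum>r\<in>W. int (card (nb S r))) = (\<Sum>s\<in>S. int (card (nb W s)))"
proof -
  have c: "int (card (nb S r)) = (\<Sum>s\<in>S. if adj r s then 1 else 0)" if "finite S" for S r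
    using that by (simp add: nb_def sum.If_cases Int_def)
  have "(\<Sum>r\<in>W. int (card (nb S r))) = (\<Sum>s\<in>S. \<Sum>r\<in>W. if adj r s then 1 else 0)"
    using assms by (simp only: c sum.swap[of _ S W])
  also have "\<dots> = (\<Sum>s\<in>S. int (card (nb W s)))"
    using assms adj_sym by (simp only: c) (intro sum.cong refl if_cong; blast)
  finally show ?thesis .
qed

lemma handshake:
  assumes "finite S" shows "(\<Sum>v\<in>S. int (card (nb S v))) = 2 * int (card (edges_in S))"
  using assms
proof (induction S rule: finite_induct)
  case empty
  then show ?case by (simp add: edges_in_def)
next
  case (insert x S)
  have "(\<Sum>v\<in>S. int (card (nb (insert x S) v))) = (\<Sum>v\<in>S. int (card (nb S v)) + int (card (nb {x} v)))"
  proof (rule sum.cong)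
    fix v assume "v \<in> S"
    have "nb (insert x S) v = nb S v \<union> nb {x} v" by (auto simp: nb_def)
    moreover have "nb S v \<inter> nb {x} v = {}" using insert.hyps by (auto simp: nb_def)
    ultimately show "int (card (nb (insert x S) v)) = int (card (nb S v)) + int (card (nb {x} v))"
      using insert.hyps by (simp add: card_Un_disjoint)
  qed simp
  also have "\<dots> = (\<Sum>v\<in>S. int (card (nb S v))) + int (card (nb S x))"
    using sum_card_nb[of "{x}" S] insert.hyps by (simp add: sum.distrib)
  finally show ?case
    using insert card_edges_in_insert[OF insert.hyps] by simp
qed

lemma pot_empty [simp]: "pot a b {} = 0"
  by (simp add: pot_def edges_in_def)

lemma pot_insert:
  assumes "finite S" "x \<notin> S"
  shows "pot a b (insert x S) = pot a b S + wt (a x) (b x) - 9 * int (card (nb S x))"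
  using assms by (simp add: pot_def card_edges_in_insert algebra_simps)

lemma pot_singleton [simp]: "pot a b {x} = wt (a x) (b x)"
  using pot_insert[of "{}" x a b] by (simp add: nb_def)

lemma pot_Un:
  assumes "finite S" "finite W" "S \<inter> W = {}"
  shows "pot a b (S \<union> W) = pot a b S + pot a b W - 9 * (\<Sum>r\<in>W. int (card (nb S r)))"
  using assms(2,3)
proof (induction W rule: finite_induct)
  case (insert x W)
  have "card (nb (S \<union> W) x) = card (nb S x) + card (nb W x)"
    unfolding nb_Un using insert assms(1)
    by (intro card_Un_disjoint) (auto simp: nb_def)
  then show ?case
    using insert assms(1) by (simp add: pot_insert algebra_simps)
qed simp

text \<open>The edges between \<open>S - W\<close> and \<open>W - S\<close> are counted in the union
  only.\<close>

lemma pot_submodular: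
  assumes "finite S" "finite W"
  shows "pot a b (S \<union> W) + pot a b (S \<inter> W) \<le> pot a b S + pot a b W"
proof -
  have 1: "pot a b (S \<union> W) = pot a b S + pot a b (W - S) - 9 * (\<Sum>r\<in>W-S. int (card (nb S r)))"
    using pot_Un[of S "W - S" a b] assms by simp
  have 2: "pot a b W = pot a b (S \<inter> W) + pot a b (W - S) - 9 * (\<Sum>r\<in>W-S. int (card (nb (S \<inter> W) r)))"
    using pot_Un[of "S \<inter> W" "W - S" a b] assms
    by (metis Diff_disjoint Int_Diff_disjoint Int_commute Int_Diff_Un finite_Diff finite_Int inf_sup_aci(5))
  have "(\<Sum>r\<in>W-S. int (card (nb (S \<inter> W) r))) \<le> (\<Sum>r\<in>W-S. int (card (nb S r)))"
    by (intro sum_mono) (simp add: assms card_mono nb_mono)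
  then show ?thesis using 1 2 by simp
qed

text \<open>Submodularity becomes subadditivity as soon as the intersections have nonnegative
  potential.\<close>

lemma pot_UN_le:
  assumes "finite I" "finite U" "\<And>i. i \<in> I \<Longrightarrow> X i \<subseteq> U \<and> pot a b (X i) \<le> t"
    and "\<And>Y. Y \<subseteq> U \<Longrightarrow> 0 \<le> pot a b Y"
  shows "pot a b (\<Union>i\<in>I. X i) \<le> t * int (card I)"
  using assms(1,3)
proof (induction I rule: finite_induct)
  case (insert i I)
  have "finite (X i)" "finite (\<Union>i\<in>I. X i)"
    using insert.prems assms(2) insert.hyps by (auto intro: finite_subset)
  then have "pot a b (X i \<union> (\<Union>i\<in>I. X i)) + pot a b (X i \<inter> (\<Union>i\<in>I. X i))
      \<le> pot a b (X i) + pot a b (\<Union>i\<in>I. X i)"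
    by (rule pot_submodular)
  moreover have "0 \<le> pot a b (X i \<inter> (\<Union>i\<in>I. X i))"
    using insert.prems by (intro assms(4)) auto
  moreover have "pot a b (X i) \<le> t" "pot a b (\<Union>i\<in>I. X i) \<le> t * int (card I)"
    using insert by auto
  ultimately show ?case
    using insert.hyps by (simp add: algebra_simps)
qed simp

text \<open>Edges among the leaves \<open>N'\<close> are ignored; they could only lower the
  potential further.\<close>

lemma pot_star_sum:
  assumes "finite S" "finite N'" "S \<inter> insert v N' = {}" "v \<notin> N'" "N' \<subseteq> nb V v"
  shows "pot a b (S \<union> insert v N') \<le> pot a b S
    + (\<Sum>r\<in>insert v N'. wt (a r) (b r) - 9 * int (card (nb S r))) - 9 * int (card N')"
proof -
  have nbv: "nb N' v = N'"
    using assms(5) by (auto simp: nb_def)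
  define A B C where "A = (\<Sum>r\<in>N'. wt (a r) (b r))" and "B = (\<Sum>r\<in>N'. int (card (nb S r)))"
    and "C = int (card (nb S v))"
  have "pot a b (insert v N') = pot a b N' + wt (a v) (b v) - 9 * int (card N')"
    using pot_insert[of N' v] assms nbv by simp
  moreover have "pot a b N' \<le> A"
    by (simp add: pot_def A_def)
  moreover have "pot a b (S \<union> insert v N') = pot a b S + pot a b (insert v N') - 9 * (C + B)"
    using pot_Un[of S "insert v N'" a b] assms by (simp add: B_def C_def)
  moreover have "(\<Sum>r\<in>insert v N'. wt (a r) (b r) - 9 * int (card (nb S r)))
      = wt (a v) (b v) - 9 * C + (A - 9 * B)"
    using assms by (simp add: A_def B_def C_def sum_subtractf flip: sum_distrib_left)
  ultimately show ?thesis
    by (smt (verit))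
qed

text \<open>The centre weighs \<open>1 + 4 * a' v\<close>; each of the \<open>a' v + 1\<close>
  leaves weighs at most 5 and has an edge of 9 to the centre. The total
  \<open>1 + 4 * a' v + (5 - 9) * (a' v + 1)\<close> is -3 whatever \<open>a' v\<close> is;
  \<open>x\<close> collects the corrections.\<close>

lemma pot_star:
  assumes "finite S" "finite N'" "S \<inter> insert v N' = {}" "v \<notin> N'" "N' \<subseteq> nb V v"
    and card: "int (card N') = a' v + 1"
    and le1: "\<And>r. r \<in> N' \<Longrightarrow> a' r \<le> 1"
    and bd: "\<And>r. r \<in> insert v N' \<Longrightarrow> wt (a r) (b r) - 9 * int (card (nb S r)) \<le> 1 + 4 * a' r + x r"
  shows "pot a b (S \<union> insert v N') \<le> pot a b S - 3 + (\<Sum>r\<in>insert v N'. x r)"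
proof -
  have "(\<Sum>r\<in>insert v N'. wt (a r) (b r) - 9 * int (card (nb S r)))
      \<le> (\<Sum>r\<in>insert v N'. 1 + 4 * a' r + x r)"
    using bd by (intro sum_mono) simp
  also have "\<dots> = 1 + 4 * a' v + (\<Sum>r\<in>N'. 1 + 4 * a' r) + (\<Sum>r\<in>insert v N'. x r)"
    using assms(2,4) by (simp add: sum.distrib)
  also have "(\<Sum>r\<in>N'. 1 + 4 * a' r) \<le> (\<Sum>r\<in>N'. 5)"
    using le1 by (intro sum_mono) force
  finally have "(\<Sum>r\<in>insert v N'. wt (a r) (b r) - 9 * int (card (nb S r)))
      \<le> 1 + 4 * a' v + 5 * int (card N') + (\<Sum>r\<in>insert v N'. x r)"
    by simp
  then show ?thesis
    using pot_star_sum[OF assms(1-5), of a b] card by linarith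
qed

section \<open>Capacities that remain after a set has been coloured\<close>

definition att :: "'a set \<Rightarrow> ('a \<Rightarrow> bool) \<Rightarrow> bool \<Rightarrow> 'a \<Rightarrow> bool" where
  "att S \<phi> i r \<longleftrightarrow> (\<exists>s\<in>S. adj r s \<and> \<phi> s = i)"

text \<open>\<open>d\<close> is an additional voluntary reduction, made to obtain slack. The floor
  -1 keeps the result within \<open>bounded_caps\<close>.\<close>

definition lower :: "'a set \<Rightarrow> ('a \<Rightarrow> bool) \<Rightarrow> bool \<Rightarrow> ('a \<Rightarrow> int) \<Rightarrow> ('a \<Rightarrow> int) \<Rightarrow> 'a \<Rightarrow> int" where
  "lower S \<phi> i c d r = (if att S \<phi> i r then -1 else max (-1) (c r - d r))"

lemma att_True: "att S (\<lambda>_. True) True r \<longleftrightarrow> nb S r \<noteq> {}"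
  by (auto simp: att_def nb_def)

lemma card_nb_att:
  assumes "finite S"
  shows "(if att S \<phi> True r then 1 else 0) + (if att S \<phi> False r then 1 else 0) \<le> int (card (nb S r))"
proof -
  have *: "card {s \<in> nb S r. \<phi> s} + card {s \<in> nb S r. \<not> \<phi> s} = card (nb S r)"
    using assms by (subst card_Un_disjoint[symmetric]) (auto intro: arg_cong[of _ _ card])
  have "att S \<phi> True r \<Longrightarrow> 0 < card {s \<in> nb S r. \<phi> s}"
       "att S \<phi> False r \<Longrightarrow> 0 < card {s \<in> nb S r. \<not> \<phi> s}"
    using assms by (auto simp: att_def nb_def card_gt_0_iff)
  then show ?thesis using * by auto
qed

text \<open>Each forbidden colour has an edge to \<open>S\<close> of its own, whose 9 covers a loss
  of at most 8 for \<open>True\<close> and at most 9 for \<open>False\<close>. The last term is a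
  refund: if the second capacity ends at -1, at least 3 of the \<open>3 * \<beta> r\<close> exceed
  the actual loss, since 0 and -1 weigh the same.\<close>

lemma wt_lower_le:
  assumes "finite S" "-1 \<le> a r" "a r \<le> 1" "-1 \<le> b r" "b r \<le> 3" "0 \<le> \<alpha> r" "0 \<le> \<beta> r"
  shows "wt (a r) (b r) - 9 * int (card (nb S r))
    \<le> wt (lower S \<phi> True a \<alpha> r) (lower S \<phi> False b \<beta> r) + 3 * \<beta> r + 4 * \<alpha> r
        - (if att S \<phi> True r then 1 else 0)
        - (if lower S \<phi> False b \<beta> r = -1 \<and> \<beta> r \<ge> 1 then 3 else 0)"
  using card_nb_att[OF assms(1), of \<phi> r] assms(2-)
  unfolding lower_def wt_def max_def
  by (cases "att S \<phi> True r"; cases "att S \<phi> False r"; simp split: if_splits)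

lemma lower_validD:
  assumes "valid (lower S \<phi> True a \<alpha>) (lower S \<phi> False b \<beta>) T \<psi>" "r \<in> T"
  shows "\<psi> r \<Longrightarrow> cdeg T \<psi> r \<le> a r - \<alpha> r" "\<not> \<psi> r \<Longrightarrow> cdeg T \<psi> r \<le> b r - \<beta> r" "\<not> att S \<phi> (\<psi> r) r"
proof -
  have "0 \<le> cdeg T \<psi> r" by (simp add: cdeg_def)
  moreover have "cdeg T \<psi> r \<le> lower S \<phi> (\<psi> r) (if \<psi> r then a else b) (if \<psi> r then \<alpha> else \<beta>) r"
    using assms by (auto simp: valid_def cap_def split: if_splits)
  ultimately show "\<psi> r \<Longrightarrow> cdeg T \<psi> r \<le> a r - \<alpha> r" "\<not> \<psi> r \<Longrightarrow> cdeg T \<psi> r \<le> b r - \<beta> r" "\<not> att S \<phi> (\<psi> r) r"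
    by (auto simp: lower_def split: if_splits)
qed

text \<open>Colours seen in \<open>S\<close> are forbidden in \<open>T\<close>, so no edge between
  the two is monochromatic. Every vertex keeps the degree it has in its own part, and the reductions
  \<alpha>, \<beta> survive as slack.\<close>

lemma glue:
  assumes "valid a b S \<phi>" "S \<inter> T = {}"
    and "valid (lower S \<phi> True a \<alpha>) (lower S \<phi> False b \<beta>) T \<psi>"
    and "\<And>r. r \<in> T \<Longrightarrow> 0 \<le> \<alpha> r" "\<And>r. r \<in> T \<Longrightarrow> 0 \<le> \<beta> r"
  defines "\<chi> \<equiv> \<lambda>x. if x \<in> S then \<phi> x else \<psi> x"
  shows "valid a b (S \<union> T) \<chi>"
    and "\<And>s. s \<in> S \<Longrightarrow> cdeg (S \<union> T) \<chi> s = cdeg S \<phi> s"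
    and "\<And>r. r \<in> T \<Longrightarrow> \<psi> r \<Longrightarrow> cdeg (S \<union> T) \<chi> r \<le> a r - \<alpha> r"
    and "\<And>r. r \<in> T \<Longrightarrow> \<not> \<psi> r \<Longrightarrow> cdeg (S \<union> T) \<chi> r \<le> b r - \<beta> r"
    and "\<And>r s. r \<in> T \<Longrightarrow> s \<in> S \<Longrightarrow> adj r s \<Longrightarrow> \<psi> r \<noteq> \<phi> s"
proof -
  show diff: "\<psi> r \<noteq> \<phi> s" if "r \<in> T" "s \<in> S" "adj r s" for r s
    using lower_validD(3)[OF assms(3) that(1)] that by (auto simp: att_def)
  show S: "cdeg (S \<union> T) \<chi> s = cdeg S \<phi> s" if "s \<in> S" for s
  proof -
    have "{r \<in> nb (S \<union> T) s. \<chi> r = \<chi> s} = {r \<in> nb S s. \<phi> r = \<phi> s}"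
      using that diff[of _ s] assms(2) by (auto simp: nb_def \<chi>_def dest: adj_sym)
    then show ?thesis by (simp add: cdeg_def)
  qed
  have T: "cdeg (S \<union> T) \<chi> r = cdeg T \<psi> r" if "r \<in> T" for r
  proof -
    have "{s \<in> nb (S \<union> T) r. \<chi> s = \<chi> r} = {s \<in> nb T r. \<psi> s = \<psi> r}"
      using that diff[of r] assms(2) by (auto simp: nb_def \<chi>_def)
    then show ?thesis by (simp add: cdeg_def)
  qed
  have T': "cdeg T \<psi> r \<le> (if \<psi> r then a r - \<alpha> r else b r - \<beta> r)" if "r \<in> T" for r
    using lower_validD(1,2)[OF assms(3) that] by simp
  show "\<And>r. r \<in> T \<Longrightarrow> \<psi> r \<Longrightarrow> cdeg (S \<union> T) \<chi> r \<le> a r - \<alpha> r"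
    and "\<And>r. r \<in> T \<Longrightarrow> \<not> \<psi> r \<Longrightarrow> cdeg (S \<union> T) \<chi> r \<le> b r - \<beta> r"
    using T' T by fastforce+
  show "valid a b (S \<union> T) \<chi>"
    unfolding valid_def
  proof
    fix x assume x: "x \<in> S \<union> T"
    show "cdeg (S \<union> T) \<chi> x \<le> cap a b (\<chi> x) x"
    proof (cases "x \<in> S")
      case True
      then show ?thesis using S[OF True] assms(1) by (simp add: valid_def \<chi>_def)
    next
      case False
      then have xT: "x \<in> T" using x by simp
      show ?thesis
        using T[OF xT] T'[OF xT] assms(4)[OF xT] assms(5)[OF xT] False
        by (auto simp: cap_def \<chi>_def split: if_splits)
    qed
  qed
qed

lemma cdeg_empty_lower:
  assumes "valid (lower {} \<phi> True a \<alpha>) (lower {} \<phi> False b \<beta>) T \<psi>"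
    and "\<And>r. 0 \<le> \<alpha> r" "\<And>r. 0 \<le> \<beta> r"
  shows "valid a b T \<psi>"
    and "\<And>r. r \<in> T \<Longrightarrow> \<psi> r \<Longrightarrow> cdeg T \<psi> r \<le> a r - \<alpha> r"
    and "\<And>r. r \<in> T \<Longrightarrow> \<not> \<psi> r \<Longrightarrow> cdeg T \<psi> r \<le> b r - \<beta> r"
proof -
  have *: "valid a b {} \<phi>" by (simp add: valid_def)
  note g = glue[OF * _ assms(1)]
  show "valid a b T \<psi>"
    using g(1) assms(2,3) by simp
  show "cdeg T \<psi> r \<le> a r - \<alpha> r" if "r \<in> T" "\<psi> r" for r
    using g(3) that assms(2,3) by simp
  show "cdeg T \<psi> r \<le> b r - \<beta> r" if "r \<in> T" "\<not> \<psi> r" for r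
    using g(4) that assms(2,3) by simp
qed

end

section \<open>Extending a partial colouring\<close>

text \<open>\<open>smaller\<close> speaks of arbitrary sets and capacities, since the induction is
  always applied after lowering capacities. \<open>no_low\<close> includes \<open>W = V\<close> and
  so bounds the potential of \<open>V\<close> from below.\<close>

locale min_counterexample = adjacency adj for adj :: "'a \<Rightarrow> 'a \<Rightarrow> bool" +
  fixes V :: "'a set" and a b :: "'a \<Rightarrow> int"
  assumes finV: "finite V"
    and caps: "bounded_caps a b V"
    and not_col: "\<not> col a b V"
    and not_overfull: "\<not> overfull a b V"
    and no_low: "\<And>W. W \<subseteq> V \<Longrightarrow> \<not> col a b W \<Longrightarrow> -5 \<le> pot a b W"
    and smaller: "\<And>T a' b'. finite T \<Longrightarrow> card T < card V \<Longrightarrow> bounded_caps a' b' T \<Longrightarrow> \<not> col a' b' T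
      \<Longrightarrow> overfull a' b' T \<or> (\<exists>W\<subseteq>T. \<not> col a' b' W \<and> pot a' b' W \<le> -6)"
begin

lemma caps_bounds: "v \<in> V \<Longrightarrow> -1 \<le> a v \<and> a v \<le> 1 \<and> -1 \<le> b v \<and> b v \<le> 3"
  using caps by (simp add: bounded_caps_def)

lemma finite_sub: "S \<subseteq> V \<Longrightarrow> finite S"
  using finV finite_subset by blast

lemma pot_V: "-5 \<le> pot a b V"
  using no_low not_col by blast

lemma overfull_mono:
  assumes "overfull a b W" "W \<subseteq> V" shows "overfull a b V"
proof -
  obtain v where v: "v \<in> W" "b v = -1" "a v + 1 \<le> int (card {r \<in> nb W v. b r = -1})"
    using assms(1) by (auto simp: overfull_def)
  have "card {r \<in> nb W v. b r = -1} \<le> card {r \<in> nb V v. b r = -1}"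
    using assms(2) finV by (intro card_mono) (auto simp: nb_def)
  then show ?thesis
    using v assms(2) by (force simp: overfull_def)
qed

lemma col_proper:
  assumes "W \<subseteq> V" "W \<noteq> V" shows "col a b W"
proof (rule ccontr)
  assume "\<not> col a b W"
  moreover have "bounded_caps a b W" using caps assms(1) by (auto simp: bounded_caps_def)
  moreover have "card W < card V" using assms finV by (simp add: psubset_card_mono psubsetI)
  ultimately have "overfull a b W \<or> (\<exists>W'\<subseteq>W. \<not> col a b W' \<and> pot a b W' \<le> -6)"
    using smaller finite_sub[OF assms(1)] by blast
  moreover have False if "W' \<subseteq> W" "\<not> col a b W'" "pot a b W' \<le> -6" for W'
    using no_low[of W'] that assms(1) by auto
  ultimately show False
    using overfull_mono assms(1) not_overfull by blast
qed

text \<open>Colour \<open>S\<close> first, forbid on the rest the colours seen in \<open>S\<close>, and reduce the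
  remaining capacities by \<open>\<alpha>\<close> and \<open>\<beta>\<close>. If this cannot be completed to a colouring of \<open>T\<close>, then
  \<open>S\<close> can be enlarged at a controlled cost: forbidding a colour is always paid for by the 9 of the
  edge responsible for it.\<close>

lemma extend_or_enlarge:
  assumes S: "S \<subseteq> V" "valid a b S \<phi>" and T: "T \<subseteq> V" "S \<inter> T = {}" "T \<noteq> V"
    and nonneg: "\<And>r. 0 \<le> \<alpha> r" "\<And>r. 0 \<le> \<beta> r"
  defines "a' \<equiv> lower S \<phi> True a \<alpha>" and "b' \<equiv> lower S \<phi> False b \<beta>"
  obtains
    (extend) \<psi> where "valid a' b' T \<psi>"
  | (enlarge) W where "W \<subseteq> T" "W \<noteq> {}"
      "pot a b (S \<union> W) \<le> pot a b S - 6 + (\<Sum>r\<in>W. 3 * \<beta> r + 4 * \<alpha> r) - int (card {r \<in> W. att S \<phi> True r})"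
  | (star) v N' where "insert v N' \<subseteq> T" "v \<notin> N'" "N' \<subseteq> nb T v" "int (card N') = a' v + 1"
      "\<And>r. r \<in> insert v N' \<Longrightarrow> b' r = -1 \<and> \<beta> r = 0"
proof (cases "col a' b' T")
  case True
  then show thesis using extend by (auto simp: col_def)
next
  case False
  have fin: "finite S" "finite T" using S T finite_sub by auto
  have rng: "-1 \<le> a r" "a r \<le> 1" "-1 \<le> b r" "b r \<le> 3" if "r \<in> T" for r
    using caps_bounds[of r] that T by auto
  have "-1 \<le> a' r \<and> a' r \<le> 1 \<and> -1 \<le> b' r \<and> b' r \<le> 3" if "r \<in> T" for r
    using rng[OF that] nonneg(1)[of r] nonneg(2)[of r] by (auto simp: a'_def b'_def lower_def)
  then have "bounded_caps a' b' T"
    by (simp add: bounded_caps_def)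
  moreover have "card T < card V"
    using T finV by (simp add: psubset_card_mono psubsetI)
  ultimately consider (over) "overfull a' b' T" | (low) "\<exists>W\<subseteq>T. \<not> col a' b' W \<and> pot a' b' W \<le> -6"
    using smaller[OF fin(2) _ _ False] by blast
  then show thesis
  proof cases
    case low
    then obtain W where W: "W \<subseteq> T" "\<not> col a' b' W" "pot a' b' W \<le> -6" by blast
    have finW: "finite W" using W fin finite_subset by blast
    have "W \<noteq> {}" using W(2) by (auto simp: col_def valid_def)
    have "(\<Sum>r\<in>W. wt (a r) (b r) - 9 * int (card (nb S r)))
        \<le> (\<Sum>r\<in>W. wt (a' r) (b' r) + (3 * \<beta> r + 4 * \<alpha> r) - (if att S \<phi> True r then 1 else 0))"
    proof (rule sum_mono)
      fix r assume "r \<in> W"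
      then have "r \<in> T" using W by blast
      then show "wt (a r) (b r) - 9 * int (card (nb S r))
          \<le> wt (a' r) (b' r) + (3 * \<beta> r + 4 * \<alpha> r) - (if att S \<phi> True r then 1 else 0)"
        using wt_lower_le[of S a r b \<alpha> \<beta> \<phi>] fin(1) rng[OF \<open>r \<in> T\<close>] nonneg(1)[of r] nonneg(2)[of r]
        unfolding a'_def b'_def by (simp split: if_splits)
    qed
    moreover have "(\<Sum>r\<in>W. if att S \<phi> True r then 1 else 0) = int (card {r \<in> W. att S \<phi> True r})"
      using finW by (simp add: sum.If_cases Int_def)
    ultimately have "pot a b W - 9 * (\<Sum>r\<in>W. int (card (nb S r)))
        \<le> pot a' b' W + (\<Sum>r\<in>W. 3 * \<beta> r + 4 * \<alpha> r) - int (card {r \<in> W. att S \<phi> True r})"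
      unfolding pot_def by (simp add: sum_subtractf sum.distrib sum_distrib_left)
    then have "pot a b (S \<union> W) \<le> pot a b S - 6 + (\<Sum>r\<in>W. 3 * \<beta> r + 4 * \<alpha> r) - int (card {r \<in> W. att S \<phi> True r})"
      using pot_Un[OF fin(1) finW, of a b] W T by (smt (verit) disjoint_iff subset_iff)
    then show thesis using enlarge W \<open>W \<noteq> {}\<close> by blast
  next
    case over
    then obtain v where v: "v \<in> T" "b' v = -1" "a' v + 1 \<le> int (card {r \<in> nb T v. b' r = -1})"
      by (auto simp: overfull_def)
    have "-1 \<le> a' v" by (simp add: a'_def lower_def)
    have "nat (a' v + 1) \<le> card {r \<in> nb T v. b' r = -1}"
      using v(3) by linarith
    from obtain_subset_with_card_n[OF this]
    obtain N' where N': "N' \<subseteq> {r \<in> nb T v. b' r = -1}" "card N' = nat (a' v + 1)"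
      by blast
    have sub: "insert v N' \<subseteq> T" "v \<notin> N'" "N' \<subseteq> nb T v" "int (card N') = a' v + 1" "finite N'"
      using N' v \<open>-1 \<le> a' v\<close> fin by (auto simp: nb_def adj_irrefl intro: finite_subset)
    have b': "b' r = -1" if "r \<in> insert v N'" for r using that N' v by auto
    show thesis
    proof (cases "\<forall>r\<in>insert v N'. \<beta> r = 0")
      case True
      show thesis by (rule star[OF sub(1-4)]) (use b' True in auto)
    next
      case False
      \<comment> \<open>A star alone yields only -3. If some capacity \<open>b\<close> in it was
        reduced voluntarily, the refund of 3 turns this into the -6 of the \<open>enlarge\<close>
        outcome.\<close>
      then obtain r0 where r0: "r0 \<in> insert v N'" "\<beta> r0 \<noteq> 0" by blast
      then have "1 \<le> \<beta> r0" using nonneg(2)[of r0] by simp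
      define x where "x = (\<lambda>r. 3 * \<beta> r + 4 * \<alpha> r - (if att S \<phi> True r then 1 else 0) - (if \<beta> r \<ge> 1 then 3 else 0))"
      have "pot a b (S \<union> insert v N') \<le> pot a b S - 3 + (\<Sum>r\<in>insert v N'. x r)"
      proof (rule pot_star[where V = T and a' = a', OF fin(1) sub(5) _ sub(2) sub(3)])
        show "S \<inter> insert v N' = {}" using sub(1) T by blast
        show "int (card N') = a' v + 1" by (rule sub(4))
        show "a' r \<le> 1" if "r \<in> N'" for r
          using that rng[of r] sub(1) nonneg(1)[of r] by (auto simp: a'_def lower_def)
        show "wt (a r) (b r) - 9 * int (card (nb S r)) \<le> 1 + 4 * a' r + x r" if "r \<in> insert v N'" for r
        proof -
          have "r \<in> T" using that sub(1) by blast
          then show ?thesis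
            using wt_lower_le[of S a r b \<alpha> \<beta> \<phi>] fin(1) rng[OF \<open>r \<in> T\<close>] nonneg(1)[of r] nonneg(2)[of r] b'[OF that]
            unfolding x_def a'_def b'_def by (simp add: wt_def split: if_splits)
        qed
      qed
      moreover have "(\<Sum>r\<in>insert v N'. if att S \<phi> True r then 1 else 0) = int (card {r \<in> insert v N'. att S \<phi> True r})"
        using sub(5) by (subst sum.If_cases) (auto simp: Int_def)
      moreover have "3 \<le> (\<Sum>r\<in>insert v N'. if \<beta> r \<ge> 1 then 3 else 0::int)"
        using member_le_sum[of r0 "insert v N'" "\<lambda>r. if \<beta> r \<ge> 1 then 3 else 0::int"] r0 \<open>1 \<le> \<beta> r0\<close> sub(5) by simp
      moreover have "(\<Sum>r\<in>insert v N'. x r) = (\<Sum>r\<in>insert v N'. 3 * \<beta> r + 4 * \<alpha> r)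
          - (\<Sum>r\<in>insert v N'. if att S \<phi> True r then 1 else 0) - (\<Sum>r\<in>insert v N'. if \<beta> r \<ge> 1 then 3 else 0)"
        unfolding x_def by (simp only: sum_subtractf)
      ultimately have "pot a b (S \<union> insert v N') \<le> pot a b S - 6
          + (\<Sum>r\<in>insert v N'. 3 * \<beta> r + 4 * \<alpha> r) - int (card {r \<in> insert v N'. att S \<phi> True r})"
        by linarith
      then show thesis using enlarge[of "insert v N'"] sub(1) by blast
    qed
  qed
qed

section \<open>Proper subsets of a minimal counterexample\<close>

text \<open>This is \<open>extend_or_enlarge\<close> for \<open>S = {}\<close>. By
  \<open>le\<close>, the vertices of a star outcome were not reduced at all, so the star would
  already make \<open>V\<close> overfull.\<close>

lemma lower_caps:
  assumes T: "T \<subseteq> V" "T \<noteq> V"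
    and nonneg: "\<And>r. 0 \<le> \<alpha> r" "\<And>r. 0 \<le> \<beta> r" and le: "\<And>r. r \<in> T \<Longrightarrow> \<beta> r = 0 \<Longrightarrow> \<alpha> r = 0"
  obtains
    (extend) \<psi> where "valid a b T \<psi>" "\<And>r. r \<in> T \<Longrightarrow> \<psi> r \<Longrightarrow> cdeg T \<psi> r \<le> a r - \<alpha> r"
      "\<And>r. r \<in> T \<Longrightarrow> \<not> \<psi> r \<Longrightarrow> cdeg T \<psi> r \<le> b r - \<beta> r"
  | (low) W where "W \<subseteq> T" "W \<noteq> {}" "pot a b W \<le> - 6 + (\<Sum>r\<in>W. 3 * \<beta> r + 4 * \<alpha> r)"
proof (rule extend_or_enlarge[of "{}" "\<lambda>_. True" T \<alpha> \<beta>])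
  show "valid a b {} (\<lambda>_. True)" by (simp add: valid_def)
  show thesis if "valid (lower {} (\<lambda>_. True) True a \<alpha>) (lower {} (\<lambda>_. True) False b \<beta>) T \<psi>" for \<psi>
    using cdeg_empty_lower[OF that nonneg] extend by blast
  show thesis if "W \<subseteq> T" "W \<noteq> {}" "pot a b ({} \<union> W) \<le> pot a b {} - 6 + (\<Sum>r\<in>W. 3 * \<beta> r + 4 * \<alpha> r)
      - int (card {r \<in> W. att {} (\<lambda>_. True) True r})" for W
    using low[of W] that by simp
  show thesis if st: "insert v N' \<subseteq> T" "v \<notin> N'" "N' \<subseteq> nb T v"
      "int (card N') = lower {} (\<lambda>_. True) True a \<alpha> v + 1"
      "\<And>r. r \<in> insert v N' \<Longrightarrow> lower {} (\<lambda>_. True) False b \<beta> r = -1 \<and> \<beta> r = 0" for v N'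
  proof -
    have cb: "-1 \<le> a r" "-1 \<le> b r" if "r \<in> insert v N'" for r
      using that st(1) T(1) caps_bounds[of r] by auto
    have "\<beta> v = 0" "\<alpha> v = 0" using st(5)[of v] le[of v] st(1) by auto
    then have card: "int (card N') = a v + 1"
      using st(4) cb[of v] by (simp add: lower_def att_def)
    have br: "b r = -1" if "r \<in> insert v N'" for r
      using st(5)[OF that] cb[OF that] by (auto simp: lower_def att_def max_def split: if_splits)
    have "N' \<subseteq> {r \<in> nb V v. b r = -1}"
      using st(3) br nb_mono[OF T(1)] by blast
    then have "card N' \<le> card {r \<in> nb V v. b r = -1}"
      using finV by (intro card_mono) auto
    then have "overfull a b V"
      using card br st(1) T(1) by (force simp: overfull_def)
    then show thesis using not_overfull by blast
  qed
qed (use T nonneg in auto)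

definition proper :: "'a set \<Rightarrow> bool" where
  "proper S \<longleftrightarrow> S \<subseteq> V \<and> S \<noteq> {} \<and> S \<noteq> V"

text \<open>If the complement of a set \<open>S\<close> of minimum potential is a forced star, then one neighbour \<open>s\<close>
  of the star can be kept away from being saturated in colour \<open>False\<close>, which leaves room for a
  vertex of the star.\<close>

lemma no_forced_complement:
  assumes S: "proper S" "-2 \<le> pot a b S" "\<And>S'. proper S' \<Longrightarrow> pot a b S \<le> pot a b S'"
    and R: "\<And>x. x \<in> V - S \<Longrightarrow> b x = -1 \<and> nb S x = {} \<or> b x = 3 \<and> card (nb S x) = 1"
      "\<And>x. x \<in> V - S \<Longrightarrow> int (card (V - S)) - 2 \<le> a x" "card (V - S) \<le> 3"
    and r: "r \<in> V - S" "b r = 3"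
  shows False
proof -
  have SV: "S \<subseteq> V" "S \<noteq> V" using S(1) by (auto simp: proper_def)
  have finS: "finite S" using SV finite_sub by blast
  define f where "f x = (SOME s. nb S x = {s})" for x
  have f: "nb S x = {f x}" if "x \<in> V - S" "b x = 3" for x
  proof -
    have "\<exists>s. nb S x = {s}" using R(1)[OF that(1)] that(2) by (auto simp: card_1_singleton_iff)
    then show ?thesis unfolding f_def by (rule someI_ex)
  qed
  define s where "s = f r"
  have s: "nb S r = {s}" using f r by (simp add: s_def)
  then have sS: "s \<in> S" by (auto simp: nb_def)
  show False
  \<comment> \<open>A failing \<open>W\<close> would have potential at most -6 + 3 = -3, below the
    minimum \<open>pot a b S\<close>.\<close>
  proof (rule lower_caps[of S "\<lambda>_. 0" "\<lambda>x. if x = s then 1 else 0"])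
    fix W assume W: "W \<subseteq> S" "W \<noteq> {}" "pot a b W \<le> - 6 + (\<Sum>r\<in>W. 3 * (if r = s then 1 else 0) + 4 * 0)"
    have "(\<Sum>r\<in>W. 3 * (if r = s then 1 else 0) + 4 * 0 :: int) \<le> 3"
      using finite_subset[OF W(1) finS] by (simp add: sum_distrib_left[symmetric])
    moreover have "proper W" using W SV by (auto simp: proper_def)
    ultimately show False using W(3) S(2) S(3)[of W] by linarith
  next
    fix \<psi> assume \<psi>: "valid a b S \<psi>"
      "\<And>x. x \<in> S \<Longrightarrow> \<not> \<psi> x \<Longrightarrow> cdeg S \<psi> x \<le> b x - (if x = s then 1 else 0)"
    \<comment> \<open>\<open>r\<close> is \<open>False\<close> even if \<open>s\<close> is: it has
      at most two neighbours outside \<open>S\<close>, and its capacity is 3. Since \<open>r\<close>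
      is \<open>False\<close>, a \<open>True\<close> vertex outside \<open>S\<close> sees at most
      \<open>card (V - S) - 2\<close> vertices of its colour.\<close>
    define \<chi> where "\<chi> x = (if x \<in> S then \<psi> x else if x = r then False else if b x = -1 then True else \<not> \<psi> (f x))" for x
    have finR: "finite (V - S)" using finV by simp
    have diff: "\<chi> y \<noteq> \<psi> x" if "x \<in> S" "y \<in> V - S" "adj x y" "y \<noteq> r" for x y
    proof -
      have "x \<in> nb S y" using that by (auto simp: nb_def dest: adj_sym)
      then have "b y = 3" "f y = x" using R(1)[OF that(2)] f[OF that(2)] by auto
      then show ?thesis using that by (simp add: \<chi>_def)
    qed
    have "cdeg V \<chi> x \<le> cap a b (\<chi> x) x" if "x \<in> V" for x
    proof (cases "x \<in> S")
      case True
      have sub: "{y \<in> nb V x. \<chi> y = \<chi> x} \<subseteq> {y \<in> nb S x. \<psi> y = \<psi> x} \<union> (if x = s \<and> \<not> \<psi> s then {r} else {})"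
      proof
        fix y assume y: "y \<in> {y \<in> nb V x. \<chi> y = \<chi> x}"
        show "y \<in> {y \<in> nb S x. \<psi> y = \<psi> x} \<union> (if x = s \<and> \<not> \<psi> s then {r} else {})"
        proof (cases "y \<in> S")
          case True
          then show ?thesis using y \<open>x \<in> S\<close> by (auto simp: nb_def \<chi>_def)
        next
          case False
          have "\<chi> x = \<psi> x" using \<open>x \<in> S\<close> by (simp add: \<chi>_def)
          then have yr: "y = r" using diff[OF \<open>x \<in> S\<close>, of y] y False by (auto simp: nb_def)
          then have "x \<in> nb S r" using y \<open>x \<in> S\<close> by (auto simp: nb_def dest: adj_sym)
          then have "x = s" using s by simp
          moreover have "\<not> \<psi> s" using y yr False \<open>x = s\<close> sS by (auto simp: \<chi>_def)
          ultimately show ?thesis using yr by simp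
        qed
      qed
      have "card {y \<in> nb V x. \<chi> y = \<chi> x} \<le> card {y \<in> nb S x. \<psi> y = \<psi> x} + (if x = s \<and> \<not> \<psi> s then 1 else 0)"
        using card_mono[OF _ sub] card_Un_le[of "{y \<in> nb S x. \<psi> y = \<psi> x}" "if x = s \<and> \<not> \<psi> s then {r} else {}"] finS
        by (auto split: if_splits)
      then have "cdeg V \<chi> x \<le> cdeg S \<psi> x + (if x = s \<and> \<not> \<psi> s then 1 else 0)"
        by (auto simp: cdeg_def)
      then show ?thesis
        using \<psi>(1) \<psi>(2)[OF True] True by (auto simp: \<chi>_def cap_def valid_def split: if_splits)
    next
      case False
      then have xR: "x \<in> V - S" using that by simp
      define Y where "Y = {y \<in> nb V x. \<chi> y = \<chi> x}"
      show ?thesis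
      proof (cases "x = r")
        case True
        have "Y \<subseteq> (V - S - {r}) \<union> nb S r"
          using True by (auto simp: Y_def nb_def adj_irrefl)
        then have "Y \<subseteq> (V - S - {r}) \<union> {s}" by (simp only: s)
        then have "card Y \<le> card ((V - S - {r}) \<union> {s})" using finR by (intro card_mono) auto
        also have "\<dots> \<le> card (V - S - {r}) + 1" using card_Un_le[of "V - S - {r}" "{s}"] by simp
        also have "\<dots> \<le> 3" using R(3) r(1) finR by (simp add: card_Diff_singleton)
        finally have "card Y \<le> 3" .
        moreover have "\<not> \<chi> x" using True r by (simp add: \<chi>_def)
        ultimately show ?thesis using True r by (simp add: Y_def cdeg_def cap_def)
      next
        case xr: False
        have inR: "y \<in> V - S - {x}" if "y \<in> Y" for y
        proof -
          have "y \<notin> S"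
          proof
            assume "y \<in> S"
            then have "\<chi> y = \<psi> y" by (simp add: \<chi>_def)
            then show False
              using that diff[OF \<open>y \<in> S\<close> xR] xr by (auto simp: Y_def nb_def dest: adj_sym)
          qed
          then show ?thesis using that by (auto simp: Y_def nb_def adj_irrefl)
        qed
        show ?thesis
        proof (cases "\<chi> x")
          case True
          have "\<not> \<chi> r" using r by (simp add: \<chi>_def)
          then have "r \<notin> Y" using True by (simp add: Y_def)
          then have "Y \<subseteq> V - S - {x} - {r}" using inR by blast
          then have "card Y \<le> card (V - S - {x} - {r})" using finR by (intro card_mono) auto
          also have "card (V - S - {x} - {r}) = card (V - S) - 2"
            using xR r(1) xr finR by (simp add: card_Diff_singleton)
          finally have "int (card Y) \<le> a x"
          proof -
            assume *: "card Y \<le> card (V - S) - 2"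
            have "{x, r} \<subseteq> V - S" using xR r(1) by simp
            then have "2 \<le> card (V - S)" using card_mono[OF finR, of "{x, r}"] xr by simp
            then show ?thesis using R(2)[OF xR] * by linarith
          qed
          then show ?thesis using True by (simp add: Y_def cdeg_def cap_def)
        next
          case nx: False
          then have "b x = 3" using R(1)[OF xR] xr False by (auto simp: \<chi>_def)
          have "Y \<subseteq> V - S - {x}" using inR by blast
          then have "card Y \<le> card (V - S - {x})" using finR by (intro card_mono) auto
          also have "\<dots> \<le> 3" using R(3) finR xR by (simp add: card_Diff_singleton)
          finally show ?thesis using nx \<open>b x = 3\<close> by (simp add: Y_def cdeg_def cap_def)
        qed
      qed
    qed
    then show False using not_col by (auto simp: col_def valid_def)
  qed (use SV in auto)
qed

text \<open>No vertex of the star is reduced voluntarily, so \<open>wt_lower_le\<close> leaves no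
  positive correction for \<open>pot_star\<close>.\<close>

lemma star_pot:
  assumes S: "S \<subseteq> V" and st: "insert v N' \<subseteq> V - S" "v \<notin> N'" "N' \<subseteq> nb T v"
    and card: "int (card N') = lower S \<phi> True a \<alpha> v + 1"
    and forced: "\<And>r. r \<in> insert v N' \<Longrightarrow> lower S \<phi> False b \<beta> r = -1 \<and> \<beta> r = 0 \<and> \<alpha> r = 0"
  shows "pot a b (S \<union> insert v N') \<le> pot a b S - 3"
proof -
  have fin: "finite S" "finite N'" using S st finV by (auto intro: finite_subset)
  have "pot a b (S \<union> insert v N') \<le> pot a b S - 3 + (\<Sum>r\<in>insert v N'. 0)"
  proof (rule pot_star[where V = T and a' = "lower S \<phi> True a \<alpha>", OF fin _ st(2,3)])
    show "S \<inter> insert v N' = {}" using st(1) by blast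
    show "int (card N') = lower S \<phi> True a \<alpha> v + 1" by (rule card)
    fix r
    show "lower S \<phi> True a \<alpha> r \<le> 1" if "r \<in> N'"
      using that st(1) forced[of r] caps_bounds[of r] by (auto simp: lower_def)
    show "wt (a r) (b r) - 9 * int (card (nb S r)) \<le> 1 + 4 * lower S \<phi> True a \<alpha> r + 0" if "r \<in> insert v N'"
      using that st(1) forced[OF that] caps_bounds[of r] wt_lower_le[OF fin(1), of a r b \<alpha> \<beta> \<phi>]
      by (auto simp: wt_def split: if_splits)
  qed
  then show ?thesis by simp
qed

text \<open>Minimality forces every enlargement of smaller potential to be \<open>V\<close>, where
  \<open>pot_V\<close> excludes a loss of 6. There remains a star filling \<open>V - S\<close>, and
  since -1 - 3 = -4 it may fall short of its maximum -3 by at most 1. This leaves either the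
  exception named in the conclusion or the configurations of
  \<open>no_forced_complement\<close>.\<close>

lemma min_proper_set:
  assumes S: "proper S" "pot a b S \<le> -1" "\<And>S'. proper S' \<Longrightarrow> pot a b S \<le> pot a b S'"
  shows "card (V - S) = 1 \<and> pot a b S = -1"
proof -
  have SV: "S \<subseteq> V" "S \<noteq> V" "S \<noteq> {}" using S(1) by (auto simp: proper_def)
  have finS: "finite S" using SV finite_sub by blast
  obtain \<phi> where \<phi>: "valid a b S \<phi>" using col_proper[OF SV(1,2)] by (auto simp: col_def)
  have whole: "S \<union> W = V" if "W \<subseteq> V - S" "pot a b (S \<union> W) < pot a b S" for W
    using that S(3)[of "S \<union> W"] SV by (auto simp: proper_def)
  show ?thesis
  proof (rule extend_or_enlarge[OF SV(1) \<phi>, of "V - S" "\<lambda>_. 0" "\<lambda>_. 0"])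
    fix \<psi> assume "valid (lower S \<phi> True a (\<lambda>_. 0)) (lower S \<phi> False b (\<lambda>_. 0)) (V - S) \<psi>"
    from glue(1)[OF \<phi> _ this] have "col a b V"
      using SV(1) by (auto simp: col_def Un_absorb1)
    then show ?thesis using not_col by simp
  next
    fix W assume W: "W \<subseteq> V - S" and le: "pot a b (S \<union> W) \<le> pot a b S - 6 + (\<Sum>r\<in>W. 3 * 0 + 4 * 0)
        - int (card {r \<in> W. att S \<phi> True r})"
    then show ?thesis using whole[OF W] pot_V S(2) by simp
  next
    fix v N' assume st: "insert v N' \<subseteq> V - S" "v \<notin> N'" "N' \<subseteq> nb (V - S) v"
      and card: "int (card N') = lower S \<phi> True a (\<lambda>_. 0) v + 1"
      and forced: "\<And>r. r \<in> insert v N' \<Longrightarrow> lower S \<phi> False b (\<lambda>_. 0) r = -1 \<and> (0::int) = 0"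
    define W where "W = insert v N'"
    define a' where "a' = lower S \<phi> True a (\<lambda>_. 0)"
    \<comment> \<open>\<open>t r\<close> is what \<open>r\<close> adds to the potential when its
      edges to \<open>S\<close> are counted but not those inside the star.\<close>
    define e where "e r = int (card (nb S r))" for r
    define t where "t r = wt (a r) (b r) - 9 * e r" for r
    have WV: "W \<subseteq> V - S" and finN: "finite N'" using st finV by (auto simp: W_def intro: finite_subset)
    have cb: "-1 \<le> a r \<and> a r \<le> 1 \<and> -1 \<le> b r \<and> b r \<le> 3" if "r \<in> W" for r
      using that WV caps_bounds[of r] by auto
    have e0: "0 \<le> e r" for r by (simp add: e_def)
    have tb: "t r \<le> 1 + 4 * a' r - (if att S \<phi> True r then 1 else 0)" if "r \<in> W" for r
      using wt_lower_le[OF finS, of a r b "\<lambda>_. 0" "\<lambda>_. 0" \<phi>] cb[OF that] forced[of r] that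
      by (simp add: t_def e_def a'_def W_def wt_def)
    have br: "b r = -1 \<or> 1 \<le> e r" if "r \<in> W" for r
      using forced[of r] that cb[OF that] card_nb_att[OF finS, of \<phi> r]
      by (auto simp: W_def lower_def max_def e_def split: if_splits)
    have a1: "a' r \<le> 1" if "r \<in> W" for r
      using cb[OF that] by (simp add: a'_def lower_def)
    have dis: "S \<inter> insert v N' = {}" using st(1) by blast
    have le3: "pot a b (S \<union> W) \<le> pot a b S - 3"
      unfolding W_def by (rule star_pot[OF SV(1) st card]) (use forced in auto)
    then have "S \<union> W = V" using whole[OF WV] by simp
    then have VS: "V - S = W" using WV by blast
    have m2: "-2 \<le> pot a b S" using le3 pot_V \<open>S \<union> W = V\<close> by simp
    have sum: "-5 \<le> pot a b S + t v + (\<Sum>r\<in>N'. t r) - 9 * int (card N')"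
      using pot_star_sum[OF finS finN dis st(2,3), of a b] pot_V \<open>S \<union> W = V\<close> finN st(2)
      by (simp add: W_def t_def e_def)
    have cardW: "int (card W) = a' v + 2" using card finN st(2) by (simp add: W_def a'_def)
    have notall: "\<exists>r\<in>W. b r \<noteq> -1" if "a' v = a v"
    proof (rule ccontr)
      assume "\<not> ?thesis"
      then have "N' \<subseteq> {r \<in> nb V v. b r = -1}" "b v = -1"
        using st(3) nb_mono[of "V - S" V v] by (auto simp: W_def)
      then have "a v + 1 \<le> int (card {r \<in> nb V v. b r = -1})"
        using card_mono[of "{r \<in> nb V v. b r = -1}" N'] finV card that by (simp add: a'_def)
      then show False using \<open>b v = -1\<close> st(1) not_overfull by (auto simp: overfull_def)
    qed
    have finish: False if R: "\<And>r. r \<in> W \<Longrightarrow> b r = -1 \<and> e r = 0 \<or> b r = 3 \<and> e r = 1"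
      and aR: "\<And>r. r \<in> W \<Longrightarrow> a' v \<le> a r" and eq: "a' v = a v"
    proof -
      obtain r where r: "r \<in> W" "b r \<noteq> -1" using notall[OF eq] by blast
      show False
      proof (rule no_forced_complement[OF S(1) m2 S(3), of r])
        show "b x = -1 \<and> nb S x = {} \<or> b x = 3 \<and> card (nb S x) = 1" if "x \<in> V - S" for x
          using R[of x] that finS by (auto simp: VS e_def)
        show "int (card (V - S)) - 2 \<le> a x" if "x \<in> V - S" for x
          using aR[of x] that cardW by (simp add: VS)
        show "card (V - S) \<le> 3" using cardW a1[of v] by (simp add: VS W_def)
        show "r \<in> V - S" "b r = 3" using r R[of r] by (auto simp: VS)
      qed
    qed
    have vW: "v \<in> W" by (simp add: W_def)
    show ?thesis
    proof (cases "N' = {}")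
      case True
      then have W1: "W = {v}" and a'v: "a' v = -1" using card by (auto simp: W_def a'_def)
      have sum1: "-5 \<le> pot a b S + t v" using sum True by simp
      show ?thesis
      \<comment> \<open>A deficit of 1 against the maximum -3 uses up the slack and forces
        \<open>pot a b S = -1\<close>.\<close>
      proof (cases "t v \<le> -4")
        case True
        then show ?thesis using sum1 S(2) VS W1 by simp
      next
        case False
        then have na: "\<not> att S \<phi> True v" and tv: "t v = -3" using tb[OF vW] a'v by (auto split: if_splits)
        then have av: "a v = -1" using a'v cb[OF vW] by (auto simp: a'_def lower_def max_def split: if_splits)
        have "b v \<noteq> -1" using notall a'v av W1 by auto
        then have "b v = 3 \<and> e v = 1"
          using tv br[OF vW] cb[OF vW] av by (simp add: t_def wt_def max_def split: if_splits)
        then have False using finish W1 a'v av by auto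
        then show ?thesis ..
      qed
    next
      case False
      then have "1 \<le> int (card N')" using finN by (simp add: Suc_leI card_gt_0_iff)
      then have a'v: "0 \<le> a' v" using card by (simp add: a'_def)
      then have av: "a' v = a v" by (auto simp: a'_def lower_def max_def split: if_splits)
      have t5: "t r \<le> 5" if "r \<in> N'" for r
        using tb[of r] a1[of r] that by (auto simp: W_def split: if_splits)
      have tv: "t v \<le> 1 + 4 * a' v" using tb[OF vW] by (auto split: if_splits)
      have "(\<Sum>r\<in>N'. t r) \<le> 5 * int (card N')"
        using sum_bounded_above[of N' t 5] t5 by simp
      then have tv': "4 * a' v \<le> t v" using sum S(2) card by (simp add: a'_def)
      have tleaf: "4 \<le> t r" if "r \<in> N'" for r
      proof -
        have "(\<Sum>r\<in>N'. t r) = t r + (\<Sum>r\<in>N' - {r}. t r)"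
          using finN that by (rule sum.remove)
        moreover have "(\<Sum>r\<in>N' - {r}. t r) \<le> 5 * (int (card N') - 1)"
          using sum_bounded_above[of "N' - {r}" t 5] t5 finN that \<open>1 \<le> int (card N')\<close>
          by (simp add: card_Diff_singleton of_nat_diff)
        ultimately show ?thesis using sum S(2) tv card by (simp add: a'_def)
      qed
      \<comment> \<open>Both listed combinations give \<open>t r = 5\<close>; every other one
        permitted by \<open>br\<close> gives at most 2.\<close>
      have leaf: "a r = 1 \<and> (b r = -1 \<and> e r = 0 \<or> b r = 3 \<and> e r = 1)" if "r \<in> N'" for r
        using tleaf[OF that] cb[of r] br[of r] e0[of r] that
        by (simp add: W_def t_def wt_def max_def split: if_splits; presburger)
      have "b v = -1 \<and> e v = 0 \<or> b v = 3 \<and> e v = 1"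
        using tv' av cb[OF vW] br[OF vW] e0[of v]
        by (simp add: t_def wt_def max_def split: if_splits; presburger)
      then have False
        using finish leaf av a1[OF vW] by (force simp: W_def)
      then show ?thesis ..
    qed
  qed (use SV in auto)
qed

lemma pot_proper_min:
  assumes "proper S" shows "-1 \<le> pot a b S \<and> (pot a b S = -1 \<longrightarrow> card (V - S) = 1)"
proof (cases "pot a b S \<le> -1")
  case True
  have "finite {S. proper S}"
    by (rule finite_subset[of _ "Pow V"]) (auto simp: proper_def finV)
  moreover have "{S. proper S} \<noteq> {}" using assms by blast
  ultimately obtain S0 where S0: "proper S0" "\<And>S'. proper S' \<Longrightarrow> pot a b S0 \<le> pot a b S'"
    using arg_min_if_finite[of "{S. proper S}" "pot a b"] by (metis mem_Collect_eq not_less)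
  have "pot a b S0 = -1"
    using min_proper_set[OF S0(1) _ S0(2)] S0(2)[OF assms] True by simp
  then have "pot a b S = -1" using S0(2)[OF assms] True by simp
  then show ?thesis
    using min_proper_set[OF assms] S0(2) \<open>pot a b S0 = -1\<close> by simp
qed simp

lemma pot_ge: "S \<subseteq> V \<Longrightarrow> S \<noteq> V \<Longrightarrow> -1 \<le> pot a b S"
  using pot_proper_min[of S] by (cases "S = {}") (auto simp: proper_def)

lemma pot_nonneg:
  assumes "S \<subseteq> V" "x \<in> V - S" "y \<in> V - S" "x \<noteq> y" shows "0 \<le> pot a b S"
proof (cases "S = {}")
  case False
  have "card {x, y} \<le> card (V - S)" using assms finV by (intro card_mono) auto
  then have "card (V - S) \<noteq> 1" using assms by simp
  moreover have "proper S" using assms False by (auto simp: proper_def)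
  ultimately show ?thesis using pot_proper_min[of S] by force
qed simp

section \<open>Links\<close>

text \<open>A link tolerates one neighbour of its own colour whichever colour it has, so its colour
  can be chosen for the benefit of its two neighbours.\<close>

definition links :: "'a set" where
  "links = {v \<in> V. a v = 1 \<and> b v = 3 \<and> card (nb V v) = 2}"

definition link_nb :: "'a \<Rightarrow> 'a set" where
  "link_nb u = {v \<in> links. adj u v}"

definition core_nb :: "'a \<Rightarrow> 'a set" where
  "core_nb u = nb V u - links"

text \<open>Meaningful for \<open>v\<close> in \<open>link_nb u\<close> with \<open>u\<close> in
  \<open>V\<close>: then \<open>nb V v\<close> consists of \<open>u\<close> and one further
  vertex.\<close>

definition other :: "'a \<Rightarrow> 'a \<Rightarrow> 'a" where
  "other u v = (SOME x. nb V v = {u, x})"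

definition rest :: "'a \<Rightarrow> 'a set" where
  "rest u = V - {u} - link_nb u"

text \<open>Two adjacent links could be added to any colouring of the remaining vertices: each takes
  the colour opposite to its outer neighbour, so it can conflict only with the other link, and one
  conflict is allowed.\<close>

lemma links_indep:
  assumes "v \<in> links" "v' \<in> links" shows "\<not> adj v v'"
proof
  assume adj: "adj v v'"
  have v: "v \<in> V" "a v = 1" "b v = 3" "card (nb V v) = 2"
    and v': "v' \<in> V" "a v' = 1" "b v' = 3" "card (nb V v') = 2"
    using assms by (auto simp: links_def)
  have ex: "\<exists>x. nb V p = {q, x} \<and> x \<noteq> q" if "card (nb V p) = 2" "q \<in> nb V p" for p q
    using that by (auto simp: card_2_iff insert_commute)
  have "v' \<in> nb V v" "v \<in> nb V v'"
    using adj v v' by (auto simp: nb_def dest: adj_sym)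
  then obtain x y where x: "nb V v = {v', x}" "x \<noteq> v'" and y: "nb V v' = {v, y}" "y \<noteq> v"
    using ex v(4) v'(4) by metis
  have "x \<in> nb V v" "y \<in> nb V v'" using x y by auto
  then have xy: "x \<noteq> v" "y \<noteq> v'" by (auto simp: nb_def adj_irrefl)
  define T where "T = V - {v, v'}"
  obtain \<psi> where \<psi>: "valid a b T \<psi>"
    using col_proper[of T] v by (auto simp: T_def col_def)
  define \<chi> where "\<chi> z = (if z = v then \<not> \<psi> x else if z = v' then \<not> \<psi> y else \<psi> z)" for z
  have vv': "v \<noteq> v'" using adj adj_irrefl by auto
  have eq: "z = x" if "z \<in> V" "adj z v" "z \<noteq> v'" for z
  proof -
    have "z \<in> nb V v" using that by (auto simp: nb_def dest: adj_sym)
    then show ?thesis using x(1) that(3) by simp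
  qed
  have eq': "z = y" if "z \<in> V" "adj z v'" "z \<noteq> v" for z
  proof -
    have "z \<in> nb V v'" using that by (auto simp: nb_def dest: adj_sym)
    then show ?thesis using y(1) that(3) by simp
  qed
  have "cdeg V \<chi> z \<le> cap a b (\<chi> z) z" if zV: "z \<in> V" for z
  proof -
    consider "z = v" | "z = v'" | "z \<in> T" using zV unfolding T_def by blast
    then show ?thesis
    proof cases
      case 1
      have "{r \<in> nb V z. \<chi> r = \<chi> z} \<subseteq> {v'}"
        using 1 x xy vv' by (auto simp: \<chi>_def)
      then have "card {r \<in> nb V z. \<chi> r = \<chi> z} \<le> 1"
        using card_mono[of "{v'}"] by force
      then have "cdeg V \<chi> z \<le> 1" by (simp add: cdeg_def)
      then show ?thesis using 1 v by (auto simp: cap_def)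
    next
      case 2
      have "{r \<in> nb V z. \<chi> r = \<chi> z} \<subseteq> {v}"
        using 2 y xy vv' by (auto simp: \<chi>_def)
      then have "card {r \<in> nb V z. \<chi> r = \<chi> z} \<le> 1"
        using card_mono[of "{v}"] by force
      then have "cdeg V \<chi> z \<le> 1" by (simp add: cdeg_def)
      then show ?thesis using 2 v' by (auto simp: cap_def)
    next
      case 3
      then have z: "z \<noteq> v" "z \<noteq> v'" "z \<in> V" by (auto simp: T_def)
      have "{r \<in> nb V z. \<chi> r = \<chi> z} = {r \<in> nb T z. \<psi> r = \<psi> z}"
        using z eq[of z] eq'[of z] by (auto simp: nb_def \<chi>_def T_def)
      then have "cdeg V \<chi> z = cdeg T \<psi> z" by (simp add: cdeg_def)
      then show ?thesis using \<psi> 3 z by (simp add: valid_def \<chi>_def)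
    qed
  qed
  then show False using not_col by (auto simp: col_def valid_def)
qed

lemma link_nb_other:
  assumes "v \<in> link_nb u" "u \<in> V"
  shows "nb V v = {u, other u v}" "other u v \<in> rest u" "other u v \<noteq> u" "v \<in> V" "v \<noteq> u"
    "a v = 1" "b v = 3"
proof -
  have v: "v \<in> links" "adj u v" "card (nb V v) = 2" and l: "v \<in> V" "a v = 1" "b v = 3"
    using assms by (auto simp: link_nb_def links_def)
  then have u: "u \<in> nb V v" using assms(2) by (auto simp: nb_def dest: adj_sym)
  have "\<exists>x. nb V v = {u, x}"
    using v(3) u by (auto simp: card_2_iff insert_commute)
  then show nb: "nb V v = {u, other u v}"
    unfolding other_def by (rule someI_ex)
  show ne: "other u v \<noteq> u"
    using nb v(3) by auto
  have o: "other u v \<in> V" "adj v (other u v)"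
    using nb by (auto simp: nb_def)
  then have "other u v \<notin> links"
    using links_indep[OF v(1)] by blast
  then show "other u v \<in> rest u"
    using o ne by (auto simp: rest_def link_nb_def)
  show "v \<in> V" "a v = 1" "b v = 3" "v \<noteq> u" using l v(2) adj_irrefl by auto
qed

lemma nb_V_split:
  "nb V u = link_nb u \<union> core_nb u" "link_nb u \<inter> core_nb u = {}"
  "finite (link_nb u)" "finite (core_nb u)" "u \<in> V \<Longrightarrow> core_nb u \<subseteq> rest u"
  using finV by (auto simp: link_nb_def core_nb_def nb_def links_def rest_def adj_irrefl)

lemma card_nb_V: "card (nb V u) = card (link_nb u) + card (core_nb u)"
  using card_Un_disjoint[OF nb_V_split(3,4,2)[of u]] nb_V_split(1)[of u] by simp

lemma nb_core:
  assumes "W \<subseteq> rest u" shows "nb W u = W \<inter> core_nb u"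
  using assms by (auto simp: nb_def rest_def core_nb_def link_nb_def)

lemma rest_sub: "rest u \<subseteq> V" "u \<in> V \<Longrightarrow> rest u \<noteq> V" "u \<notin> rest u"
  by (auto simp: rest_def)

text \<open>Colour \<open>u\<close> with \<open>i\<close>. A link of \<open>u\<close> whose other end has the colour \<open>\<not> i\<close> also gets \<open>i\<close>,
  unless it belongs to the exempt set \<open>E\<close>, whose elements rely on spare capacity at the other end.\<close>

lemma no_extension:
  assumes u: "u \<in> V" and \<psi>: "valid a b (rest u) \<psi>"
    and h1: "int (card {z \<in> core_nb u. \<psi> z = i}) + int (card {v \<in> link_nb u. \<psi> (other u v) \<noteq> i \<and> v \<notin> E}) \<le> cap a b i u"
    and h2: "\<And>z. z \<in> core_nb u \<Longrightarrow> \<psi> z = i \<Longrightarrow> cdeg (rest u) \<psi> z + 1 \<le> cap a b i z"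
    and h3: "\<And>x. x \<in> rest u \<Longrightarrow> \<psi> x \<noteq> i \<Longrightarrow>
      cdeg (rest u) \<psi> x + int (card {v \<in> link_nb u. v \<in> E \<and> other u v = x}) \<le> cap a b (\<psi> x) x"
  shows False
proof -
  define Q where "Q = {v \<in> link_nb u. \<psi> (other u v) \<noteq> i \<and> v \<notin> E}"
  define \<chi> where "\<chi> x = (if x = u then i else if x \<in> link_nb u then (if x \<in> Q then i else \<not> i) else \<psi> x)" for x
  have \<chi>T: "\<chi> x = \<psi> x" if "x \<in> rest u" for x using that by (simp add: \<chi>_def rest_def)
  have fin: "finite (rest u)" using finite_sub rest_sub by blast
  have "cdeg V \<chi> x \<le> cap a b (\<chi> x) x" if xV: "x \<in> V" for x
  proof -
    consider "x = u" | "x \<in> link_nb u" "x \<noteq> u" | "x \<in> rest u" using xV by (auto simp: rest_def)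
    then show ?thesis
    proof cases
      case 1
      have "{r \<in> nb V x. \<chi> r = \<chi> x} \<subseteq> {z \<in> core_nb u. \<psi> z = i} \<union> Q"
      proof
        fix r assume r: "r \<in> {r \<in> nb V x. \<chi> r = \<chi> x}"
        then have *: "r \<in> link_nb u \<union> core_nb u" and "\<chi> r = i" using 1 nb_V_split(1)[of u] by (auto simp: \<chi>_def)
        from * show "r \<in> {z \<in> core_nb u. \<psi> z = i} \<union> Q"
        proof
          assume "r \<in> link_nb u"
          then show ?thesis using \<open>\<chi> r = i\<close> link_nb_other(5)[OF _ u] by (auto simp: \<chi>_def split: if_splits)
        next
          assume "r \<in> core_nb u"
          then show ?thesis using \<open>\<chi> r = i\<close> \<chi>T[of r] nb_V_split(5)[OF u] by auto
        qed
      qed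
      then have "card {r \<in> nb V x. \<chi> r = \<chi> x} \<le> card ({z \<in> core_nb u. \<psi> z = i} \<union> Q)"
        using nb_V_split(3,4) by (intro card_mono) (auto simp: Q_def)
      also have "\<dots> \<le> card {z \<in> core_nb u. \<psi> z = i} + card Q" by (rule card_Un_le)
      finally show ?thesis using h1 1 by (simp add: cdeg_def Q_def \<chi>_def)
    next
      case 2
      note o = link_nb_other[OF 2(1) u]
      have "{r \<in> nb V x. \<chi> r = \<chi> x} \<subseteq> (if x \<in> Q then {u} else {other u x})"
        using 2 o \<chi>T[OF o(2)] by (auto simp: \<chi>_def Q_def split: if_splits)
      then have "card {r \<in> nb V x. \<chi> r = \<chi> x} \<le> card (if x \<in> Q then {u} else {other u x})"
        by (intro card_mono) auto
      then have "card {r \<in> nb V x. \<chi> r = \<chi> x} \<le> 1" by (simp split: if_splits)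
      then have "cdeg V \<chi> x \<le> 1" by (simp add: cdeg_def)
      then show ?thesis using o(6,7) by (auto simp: cap_def)
    next
      case 3
      define C where "C = {r \<in> nb (rest u) x. \<psi> r = \<psi> x}"
      have Ceq: "int (card C) = cdeg (rest u) \<psi> x" by (simp add: C_def cdeg_def)
      have finC: "finite C" using fin by (simp add: C_def)
      have other_x: "other u v = x" if "v \<in> link_nb u" "adj x v" for v
      proof -
        have "x \<in> nb V v" using that(2) xV by (auto simp: nb_def dest: adj_sym)
        then show ?thesis using link_nb_other(1)[OF that(1) u] 3 by (auto simp: rest_def)
      qed
      show ?thesis
      proof (cases "\<psi> x = i")
        case True
        have "{r \<in> nb V x. \<chi> r = \<chi> x} \<subseteq> C \<union> (if x \<in> core_nb u then {u} else {})"
        proof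
          fix r assume r: "r \<in> {r \<in> nb V x. \<chi> r = \<chi> x}"
          then have rV: "r \<in> V" "adj x r" "\<chi> r = i" using \<chi>T[OF 3] True by (auto simp: nb_def)
          consider "r = u" | "r \<in> link_nb u" | "r \<in> rest u" using rV by (auto simp: rest_def)
          then show "r \<in> C \<union> (if x \<in> core_nb u then {u} else {})"
          proof cases
            case 1
            then have "x \<in> nb V u" using rV xV by (auto simp: nb_def dest: adj_sym)
            then have "x \<in> core_nb u" using nb_V_split(1)[of u] 3 by (auto simp: rest_def)
            then show ?thesis using 1 by simp
          next
            case 2
            then have "r \<notin> Q" using other_x[OF 2 rV(2)] True by (simp add: Q_def)
            then show ?thesis using 2 rV link_nb_other(5)[OF 2 u] by (simp add: \<chi>_def)
          next
            case 3
            then show ?thesis using rV \<chi>T[OF 3] True by (simp add: C_def nb_def)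
          qed
        qed
        then have "card {r \<in> nb V x. \<chi> r = \<chi> x} \<le> card (C \<union> (if x \<in> core_nb u then {u} else {}))"
          using finC by (intro card_mono) auto
        also have "\<dots> \<le> card C + card (if x \<in> core_nb u then {u} else {})" by (rule card_Un_le)
        finally have "cdeg V \<chi> x \<le> cdeg (rest u) \<psi> x + (if x \<in> core_nb u then 1 else 0)"
          using Ceq by (auto simp: cdeg_def split: if_splits)
        then show ?thesis using h2[of x] \<psi> 3 True \<chi>T[OF 3] by (auto simp: valid_def split: if_splits)
      next
        case False
        have "{r \<in> nb V x. \<chi> r = \<chi> x} \<subseteq> C \<union> {v \<in> link_nb u. v \<in> E \<and> other u v = x}"
        proof
          fix r assume r: "r \<in> {r \<in> nb V x. \<chi> r = \<chi> x}"
          then have rV: "r \<in> V" "adj x r" "\<chi> r = \<psi> x" using \<chi>T[OF 3] by (auto simp: nb_def)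
          consider "r = u" | "r \<in> link_nb u" | "r \<in> rest u" using rV by (auto simp: rest_def)
          then show "r \<in> C \<union> {v \<in> link_nb u. v \<in> E \<and> other u v = x}"
          proof cases
            case 1
            then show ?thesis using rV False by (simp add: \<chi>_def)
          next
            case 2
            then have "r \<notin> Q" using rV False link_nb_other(5)[OF 2 u] by (auto simp: \<chi>_def)
            then show ?thesis using 2 other_x[OF 2 rV(2)] False by (auto simp: Q_def)
          next
            case 3
            then show ?thesis using rV \<chi>T[OF 3] by (simp add: C_def nb_def)
          qed
        qed
        then have "card {r \<in> nb V x. \<chi> r = \<chi> x} \<le> card (C \<union> {v \<in> link_nb u. v \<in> E \<and> other u v = x})"
          using finC nb_V_split(3) by (intro card_mono) auto
        also have "\<dots> \<le> card C + card {v \<in> link_nb u. v \<in> E \<and> other u v = x}" by (rule card_Un_le)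
        finally have "cdeg V \<chi> x \<le> cdeg (rest u) \<psi> x + int (card {v \<in> link_nb u. v \<in> E \<and> other u v = x})"
          using Ceq by (simp add: cdeg_def)
        then show ?thesis using h3[OF 3 False] \<chi>T[OF 3] by simp
      qed
    qed
  qed
  then show False using not_col by (auto simp: col_def valid_def)
qed

text \<open>In a colouring of \<open>rest u\<close>, \<open>n1\<close> and \<open>n2\<close> count
  the links whose other end is \<open>True\<close> and \<open>False\<close>, \<open>m1\<close> and
  \<open>m2\<close> the core neighbours of colour \<open>True\<close> and \<open>False\<close>.
  Slack is bought only at \<open>False\<close> core neighbours. Hence colour \<open>False\<close>
  for \<open>u\<close> can fail only at \<open>u\<close> itself, whereas colour \<open>True\<close>
  may also fail because of a single \<open>True\<close> core neighbour.\<close>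

lemma core_degree:
  assumes u: "u \<in> V" "u \<notin> links"
  obtains n1 n2 m1 m2 where "n1 + n2 = card (link_nb u)" "m1 + m2 = card (core_nb u)"
    "b u + 1 \<le> int (n1 + m2)" "1 \<le> m1 \<or> a u + 1 \<le> int n2"
proof (rule lower_caps[of "rest u" "\<lambda>_. 0" "\<lambda>x. if x \<in> core_nb u then 1 else 0"])
  fix W assume W: "W \<subseteq> rest u" "W \<noteq> {}"
    and le: "pot a b W \<le> - 6 + (\<Sum>r\<in>W. 3 * (if r \<in> core_nb u then 1 else 0) + 4 * 0)"
  have finW: "finite W" using W rest_sub finite_sub by blast
  define M where "M = card (W \<inter> core_nb u)"
  have "(\<Sum>r\<in>W. 3 * (if r \<in> core_nb u then 1 else 0) + 4 * 0 :: int) = 3 * int M"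
    using finW by (simp add: M_def sum.If_cases flip: sum_distrib_left)
  then have le: "pot a b W \<le> -6 + 3 * int M" using le by simp
  have "-1 \<le> pot a b W" using W rest_sub u(1) by (intro pot_ge) blast+
  then have M2: "2 \<le> M" using le by linarith
  have "u \<notin> W" using W rest_sub by blast
  \<comment> \<open>Each of the \<open>M\<close> core neighbours in \<open>W\<close> was charged 3
    but also gives an edge of 9 to \<open>u\<close>. With \<open>2 \<le> M\<close> and weight at
    most 14, this leaves only \<open>insert u W = V\<close>, \<open>M = 2\<close> and weight 14,
    that is, a link.\<close>
  then have pot: "pot a b (insert u W) \<le> -6 + wt (a u) (b u) - 6 * int M"
    using pot_insert[OF finW, of u a b] nb_core[OF W(1)] le by (simp add: M_def)
  have "wt (a u) (b u) \<le> 14" using caps_bounds[OF u(1)] by (simp add: wt_def max_def)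
  show thesis
  proof (cases "insert u W = V")
    case False
    then have "-1 \<le> pot a b (insert u W)"
      using W rest_sub u(1) by (intro pot_ge) blast+
    then show thesis using pot M2 \<open>wt (a u) (b u) \<le> 14\<close> by linarith
  next
    case True
    then have deg: "card (nb V u) = M"
      using nb_core[OF W(1)] by (metis M_def nb_insert_self)
    have "6 * int M + 1 \<le> wt (a u) (b u)" using pot_V pot True by simp
    then have "M = 2" "13 \<le> wt (a u) (b u)" using M2 \<open>wt (a u) (b u) \<le> 14\<close> by linarith+
    then have "a u = 1 \<and> b u = 3"
      using caps_bounds[OF u(1)] unfolding wt_def max_def by (smt (verit))
    then have "u \<in> links" using deg \<open>M = 2\<close> u(1) by (simp add: links_def)
    then show thesis using u(2) by blast
  qed
next
  fix \<psi> assume \<psi>: "valid a b (rest u) \<psi>"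
    and "\<And>r. r \<in> rest u \<Longrightarrow> \<not> \<psi> r \<Longrightarrow> cdeg (rest u) \<psi> r \<le> b r - (if r \<in> core_nb u then 1 else 0)"
  then have slack: "cdeg (rest u) \<psi> z + 1 \<le> b z" if "z \<in> core_nb u" "\<not> \<psi> z" for z
    using that nb_V_split(5)[OF u(1)] by force
  define n1 n2 m1 m2 where "n1 = card {v \<in> link_nb u. \<psi> (other u v)}"
    and "n2 = card {v \<in> link_nb u. \<not> \<psi> (other u v)}"
    and "m1 = card {z \<in> core_nb u. \<psi> z}" and "m2 = card {z \<in> core_nb u. \<not> \<psi> z}"
  have split: "card {x \<in> Y. P x} + card {x \<in> Y. \<not> P x} = card Y" if "finite Y" for Y :: "'a set" and P
    using that by (subst card_Un_disjoint[symmetric]) (auto intro: arg_cong[of _ _ card])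
  have "n1 + n2 = card (link_nb u)" "m1 + m2 = card (core_nb u)"
    using split nb_V_split(3,4) by (simp_all add: n1_def n2_def m1_def m2_def)
  moreover have val: "\<psi> x \<Longrightarrow> cdeg (rest u) \<psi> x \<le> a x" "\<not> \<psi> x \<Longrightarrow> cdeg (rest u) \<psi> x \<le> b x" if "x \<in> rest u" for x
    using \<psi> that by (auto simp: valid_def cap_def)
  moreover have "\<not> int (n1 + m2) \<le> b u"
  proof
    assume "int (n1 + m2) \<le> b u"
    then show False
      by (intro no_extension[OF u(1) \<psi>, of False "{}"])
        (use slack val in \<open>auto simp: n1_def m2_def cap_def split: if_splits\<close>)
  qed
  moreover have "\<not> (m1 = 0 \<and> int n2 \<le> a u)"
  proof
    assume *: "m1 = 0 \<and> int n2 \<le> a u"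
    then have "{z \<in> core_nb u. \<psi> z} = {}" using nb_V_split(4) by (simp add: m1_def)
    then show False
      using * by (intro no_extension[OF u(1) \<psi>, of True "{}"])
        (use val in \<open>auto simp: n2_def m1_def cap_def split: if_splits\<close>)
  qed
  ultimately show thesis using that[of n1 n2 m1 m2] by linarith
qed (use rest_sub u in auto)

text \<open>Each added link weighs 14 and has exactly two edges into \<open>U\<close>; there are no
  edges among links.\<close>

lemma pot_add_links:
  assumes "u \<in> V" "U \<subseteq> V" "u \<in> U" "U \<inter> link_nb u = {}"
  shows "pot a b (U \<union> {v \<in> link_nb u. other u v \<in> U}) = pot a b U - 4 * int (card {v \<in> link_nb u. other u v \<in> U})"
proof -
  define M where "M = {v \<in> link_nb u. other u v \<in> U}"
  have finM: "finite M" using nb_V_split(3) by (simp add: M_def)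
  have M: "v \<in> link_nb u" "other u v \<in> U" if "v \<in> M" for v using that by (auto simp: M_def)
  have "edges_in M = {}"
    using links_indep M(1) by (auto simp: edges_in_def link_nb_def)
  then have "pot a b M = (\<Sum>v\<in>M. 14)"
    unfolding pot_def using link_nb_other(6,7)[OF M(1) assms(1)] by (simp add: wt_def)
  moreover have "card (nb U v) = 2" if "v \<in> M" for v
  proof -
    note o = link_nb_other[OF M(1)[OF that] assms(1)]
    have "adj v u" "adj v (other u v)" using o(1) by (auto simp: nb_def)
    moreover have "x \<in> {u, other u v}" if "x \<in> U" "adj v x" for x
      using that o(1) assms(2) by (auto simp: nb_def)
    ultimately have "nb U v = {u, other u v}"
      using assms(3) M(2)[OF that] by (auto simp: nb_def)
    then show ?thesis using o(3) by simp
  qed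
  moreover have "U \<inter> M = {}" using assms(4) M(1) by blast
  ultimately show ?thesis
    using pot_Un[OF finite_sub[OF assms(2)] finM, of a b] unfolding M_def[symmetric] by simp
qed

section \<open>Vertices with a tight number of links\<close>

text \<open>\<open>Y\<close> misses at least the two vertices \<open>u\<close> and
  \<open>v\<close>.\<close>

lemma pot_rest_nonneg:
  assumes "u \<in> V" "v \<in> link_nb u" "Y \<subseteq> rest u" shows "0 \<le> pot a b Y"
  using pot_nonneg[of Y u v] assms link_nb_other(4,5)[OF assms(2,1)] by (auto simp: rest_def)

lemma pot_add_vertex_links:
  assumes u: "u \<in> V" and U: "U \<subseteq> rest u" "core_nb u \<subseteq> U"
  defines "M \<equiv> {v \<in> link_nb u. other u v \<in> U}"
  shows "pot a b (insert u U \<union> M) = pot a b U + wt (a u) (b u) - 9 * int (card (core_nb u)) - 4 * int (card M)"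
proof -
  have "{v \<in> link_nb u. other u v \<in> insert u U} = M"
    using link_nb_other(3)[OF _ u] by (auto simp: M_def)
  moreover have "insert u U \<subseteq> V" "insert u U \<inter> link_nb u = {}" "u \<notin> U"
    using u U(1) link_nb_other(5)[OF _ u] by (auto simp: rest_def)
  ultimately have "pot a b (insert u U \<union> M) = pot a b (insert u U) - 4 * int (card M)"
    using pot_add_links[OF u, of "insert u U"] by simp
  moreover have "pot a b (insert u U) = pot a b U + wt (a u) (b u) - 9 * int (card (nb U u))"
    using \<open>u \<notin> U\<close> \<open>insert u U \<subseteq> V\<close> finite_sub[of U] by (intro pot_insert) auto
  moreover have "nb U u = core_nb u"
    using nb_core[OF U(1)] U(2) by blast
  ultimately show ?thesis by simp
qed

text \<open>Unite some of the sets \<open>X v\<close>, then add \<open>u\<close> and all links whose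
  other end is covered. If every link is covered, only the bound -5 is available, so the union may
  use no more than \<open>k - 2\<close> sets. If exactly one link is missed, so is its other end;
  the potential is then nonnegative and \<open>k - 1\<close> sets are affordable.\<close>

lemma cover_contradiction:
  assumes u: "u \<in> V" and k: "3 \<le> card (link_nb u)"
    and X: "\<And>v. v \<in> link_nb u \<Longrightarrow> X v \<subseteq> rest u \<and> core_nb u \<subseteq> X v \<and> other u v \<in> X v \<and> pot a b (X v) \<le> t"
  defines "k \<equiv> int (card (link_nb u))" and "e \<equiv> wt (a u) (b u) - 9 * int (card (core_nb u))"
  assumes num: "t * (k - 2) + e - 4 * (k - 1) < 0" "t * (k - 2) + e - 4 * k \<le> -6" "t * (k - 1) + e - 4 * (k - 1) < 0"
  shows False
proof -
  define L where "L = link_nb u"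
  have finL: "finite L" using nb_V_split(3) by (simp add: L_def)
  define U where "U I = (\<Union>v\<in>I. X v)" for I
  have UL: "U I \<subseteq> rest u \<and> core_nb u \<subseteq> U I \<and> pot a b (U I) \<le> t * int (card I)" if I: "I \<subseteq> L" "I \<noteq> {}" for I
  proof -
    obtain v0 where "v0 \<in> I" using I(2) by blast
    then have v0: "v0 \<in> link_nb u" using I by (auto simp: L_def)
    have "pot a b (\<Union>v\<in>I. X v) \<le> t * int (card I)"
    proof (rule pot_UN_le)
      show "finite I" using I finL finite_subset by blast
      show "finite (rest u)" using rest_sub finite_sub by blast
      show "X v \<subseteq> rest u \<and> pot a b (X v) \<le> t" if "v \<in> I" for v
        using that \<open>I \<subseteq> L\<close> X by (auto simp: L_def)
      show "0 \<le> pot a b Y" if "Y \<subseteq> rest u" for Y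
        using pot_rest_nonneg[OF u v0 that] .
    qed
    then show ?thesis using I X \<open>v0 \<in> I\<close> v0 by (auto simp: U_def L_def)
  qed
  have all: False if "I \<subseteq> L" "I \<noteq> {}" "{v \<in> L. other u v \<in> U I} = L" "int (card I) = k - 2" for I
  proof -
    have "pot a b (insert u (U I) \<union> L) = pot a b (U I) + e - 4 * k"
      using pot_add_vertex_links[OF u, of "U I"] UL[OF that(1,2)] that(3) by (simp add: L_def e_def k_def)
    moreover have "insert u (U I) \<union> L \<subseteq> V"
      using u UL[OF that(1,2)] rest_sub(1)[of u] by (auto simp: L_def link_nb_def links_def)
    then have "-5 \<le> pot a b (insert u (U I) \<union> L)"
      using pot_ge[of "insert u (U I) \<union> L"] pot_V by (cases "insert u (U I) \<union> L = V") auto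
    ultimately show False using UL[OF that(1,2)] num(2) that(4) by simp
  qed
  have miss: "0 \<le> t * int (card I) + e - 4 * (k - 1)"
    if "I \<subseteq> L" "I \<noteq> {}" "x \<in> L" "{v \<in> L. other u v \<in> U I} = L - {x}" for I x
  proof -
    have "int (card (L - {x})) = k - 1"
      using that(3) finL card_Suc_Diff1[OF finL that(3)] by (simp add: k_def L_def)
    then have "pot a b (insert u (U I) \<union> (L - {x})) = pot a b (U I) + e - 4 * (k - 1)"
      using pot_add_vertex_links[OF u, of "U I"] UL[OF that(1,2)] that(4) by (simp add: L_def e_def)
    moreover have "0 \<le> pot a b (insert u (U I) \<union> (L - {x}))"
    proof (rule pot_nonneg)
      have x: "x \<in> link_nb u" using that(3) by (simp add: L_def)
      note o = link_nb_other[OF x u]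
      show "insert u (U I) \<union> (L - {x}) \<subseteq> V"
        using u UL[OF that(1,2)] rest_sub(1)[of u] by (auto simp: L_def link_nb_def links_def)
      show "x \<in> V - (insert u (U I) \<union> (L - {x}))"
        using o x UL[OF that(1,2)] by (auto simp: rest_def)
      have "other u x \<notin> U I" using that(3,4) by blast
      then show "other u x \<in> V - (insert u (U I) \<union> (L - {x}))"
        using o by (auto simp: rest_def L_def)
      show "x \<noteq> other u x" using o(2) x by (auto simp: rest_def)
    qed
    ultimately show ?thesis using UL[OF that(1,2)] by linarith
  qed
  have cov: "v \<in> I \<Longrightarrow> I \<subseteq> L \<Longrightarrow> other u v \<in> U I" for v I
    using X by (auto simp: U_def L_def)
  show False
  \<comment> \<open>If \<open>X v0\<close> contains the end of a second link \<open>v1\<close>, both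
    \<open>X v1\<close> and the set of a third link \<open>x\<close> can be omitted, and at most
    \<open>x\<close> stays uncovered. Otherwise the sets other than \<open>X x\<close> miss exactly
    \<open>x\<close>.\<close>
  proof (cases "\<exists>v0\<in>L. \<exists>v1\<in>L. v0 \<noteq> v1 \<and> other u v1 \<in> X v0")
    case True
    then obtain v0 v1 where v: "v0 \<in> L" "v1 \<in> L" "v0 \<noteq> v1" "other u v1 \<in> X v0" by blast
    have "card {v0, v1} < card L" using k v(3) by (simp add: L_def)
    then obtain x where x: "x \<in> L" "x \<noteq> v0" "x \<noteq> v1"
      by (metis card_mono finite.emptyI finite_insert insertCI not_less subsetI)
    define I where "I = L - {v1, x}"
    have I: "I \<subseteq> L" "I \<noteq> {}" using v x by (auto simp: I_def)
    have "card I = card L - card {v1, x}"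
      unfolding I_def using v x finL by (intro card_Diff_subset) auto
    then have cI: "int (card I) = k - 2" using k x by (simp add: k_def L_def)
    have sub: "L - {x} \<subseteq> {v \<in> L. other u v \<in> U I}"
    proof
      fix v assume "v \<in> L - {x}"
      then show "v \<in> {v \<in> L. other u v \<in> U I}"
        using cov[of v I] I v x by (cases "v = v1") (auto simp: I_def U_def)
    qed
    show False
    proof (cases "other u x \<in> U I")
      case True
      then have "{v \<in> L. other u v \<in> U I} = L" using sub by blast
      then show False using all[OF I] cI by blast
    next
      case False
      then have "{v \<in> L. other u v \<in> U I} = L - {x}" using sub by blast
      then show False using miss[OF I x(1)] cI num(1) by simp
    qed
  next
    case False
    have "L \<noteq> {}" using k by (auto simp: L_def)
    then obtain x where x: "x \<in> L" by blast
    have cL: "int (card (L - {x})) = k - 1"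
      using x finL card_Suc_Diff1[OF finL x] by (simp add: k_def L_def)
    have "card (L - {x}) \<noteq> 0" using cL k by (simp add: k_def)
    then have I: "L - {x} \<subseteq> L" "L - {x} \<noteq> {}" by force+
    have "other u x \<notin> U (L - {x})" using False x by (auto simp: U_def)
    then have "{v \<in> L. other u v \<in> U (L - {x})} = L - {x}" using cov[OF _ I(1)] by blast
    then show False using miss[OF I x] cL num(3) by simp
  qed
qed

lemma no_extension_plain:
  assumes "u \<in> V" and \<psi>: "valid a b (rest u) \<psi>"
    and "int (card {z \<in> core_nb u. \<psi> z = i}) + int (card {v \<in> link_nb u. \<psi> (other u v) \<noteq> i}) \<le> cap a b i u"
    and "\<And>z. z \<in> core_nb u \<Longrightarrow> \<psi> z = i \<Longrightarrow> cdeg (rest u) \<psi> z + 1 \<le> cap a b i z"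
  shows False
  using \<psi> by (intro no_extension[of u \<psi> i "{}"]) (use assms in \<open>auto simp: valid_def\<close>)

text \<open>Exempting the single link \<open>v\<close> saves one unit at \<open>u\<close> and spends
  the spare unit at its other end.\<close>

lemma no_extension_slack:
  assumes u: "u \<in> V" and \<psi>: "valid a b (rest u) \<psi>" and v: "v \<in> link_nb u" "\<psi> (other u v) = (\<not> i)"
    and slack: "cdeg (rest u) \<psi> (other u v) + 1 \<le> cap a b (\<not> i) (other u v)"
    and h1: "int (card {z \<in> core_nb u. \<psi> z = i}) + int (card {v \<in> link_nb u. \<psi> (other u v) \<noteq> i}) \<le> cap a b i u + 1"
    and h2: "\<And>z. z \<in> core_nb u \<Longrightarrow> \<psi> z = i \<Longrightarrow> cdeg (rest u) \<psi> z + 1 \<le> cap a b i z"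
  shows False
proof (rule no_extension[OF u \<psi>, of i "{v}"])
  have "{v' \<in> link_nb u. \<psi> (other u v') \<noteq> i \<and> v' \<notin> {v}} = {v' \<in> link_nb u. \<psi> (other u v') \<noteq> i} - {v}" by blast
  moreover have "Suc (card ({v' \<in> link_nb u. \<psi> (other u v') \<noteq> i} - {v})) = card {v' \<in> link_nb u. \<psi> (other u v') \<noteq> i}"
    using v nb_V_split(3)[of u] by (intro card_Suc_Diff1) auto
  ultimately show "int (card {z \<in> core_nb u. \<psi> z = i}) + int (card {v' \<in> link_nb u. \<psi> (other u v') \<noteq> i \<and> v' \<notin> {v}}) \<le> cap a b i u"
    using h1 by simp
  show "cdeg (rest u) \<psi> z + 1 \<le> cap a b i z" if "z \<in> core_nb u" "\<psi> z = i" for z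
    using h2 that .
  show "cdeg (rest u) \<psi> x + int (card {v' \<in> link_nb u. v' \<in> {v} \<and> other u v' = x}) \<le> cap a b (\<psi> x) x"
    if x: "x \<in> rest u" "\<psi> x \<noteq> i" for x
  proof (cases "x = other u v")
    case True
    have "{v' \<in> link_nb u. v' \<in> {v} \<and> other u v' = x} = {v}" using v True by auto
    then show ?thesis using slack v(2) True by simp
  next
    case False
    then have "{v' \<in> link_nb u. v' \<in> {v} \<and> other u v' = x} = {}" by auto
    moreover have "cdeg (rest u) \<psi> x \<le> cap a b (\<psi> x) x" using \<psi> x(1) by (simp add: valid_def)
    ultimately show ?thesis by (simp only: card.empty of_nat_0 add_0_right)
  qed
qed

lemma card_link_split:
  "card {v \<in> link_nb u. P v} + card {v \<in> link_nb u. \<not> P v} = card (link_nb u)"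
  using nb_V_split(3)[of u] by (subst card_Un_disjoint[symmetric]) (auto intro: arg_cong[of _ _ card])

lemma sum_single: "(\<Sum>r\<in>W. 3 * (if r = w then 1 else 0) + 4 * (if r = w then 1 else 0)) \<le> (7::int)"
  "w \<notin> W \<Longrightarrow> (\<Sum>r\<in>W. 3 * (if r = w then 1 else 0) + 4 * (if r = w then 1 else 0)) = (0::int)"
proof -
  have eq: "(\<Sum>r\<in>W. 3 * (if r = w then 1 else 0) + 4 * (if r = w then 1 else 0)) = (\<Sum>r\<in>W. if r = w then 7 else 0::int)"
    by (rule sum.cong) auto
  show "(\<Sum>r\<in>W. 3 * (if r = w then 1 else 0) + 4 * (if r = w then 1 else 0)) \<le> (7::int)"
    unfolding eq by (cases "finite W") auto
  show "w \<notin> W \<Longrightarrow> (\<Sum>r\<in>W. 3 * (if r = w then 1 else 0) + 4 * (if r = w then 1 else 0)) = (0::int)"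
    unfolding eq by (rule sum.neutral) auto
qed

text \<open>Counting gives \<open>n1 = b u + 1\<close> and \<open>n2 = 2\<close>, so either colour
  of \<open>u\<close> fails by exactly one. Slack at the end of any one link would repair this.
  Slack in both colours costs 7, and its refusal yields a set of potential at most -6 + 7 = 1 around
  that end.\<close>

lemma no_tight_link_star:
  assumes u: "u \<in> V" "a u = 1" "0 \<le> b u" and B: "core_nb u = {}" and k: "int (card (link_nb u)) = b u + 3"
  shows False
proof -
  have "\<exists>X. X \<subseteq> rest u \<and> core_nb u \<subseteq> X \<and> other u v \<in> X \<and> pot a b X \<le> 1" if v: "v \<in> link_nb u" for v
  proof -
    define w where "w = other u v"
    have w: "w \<in> rest u" using link_nb_other(2)[OF v u(1)] by (simp add: w_def)
    show ?thesis
    proof (rule lower_caps[of "rest u" "\<lambda>x. if x = w then 1 else 0" "\<lambda>x. if x = w then 1 else 0"])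
      fix W assume W: "W \<subseteq> rest u" "W \<noteq> {}"
        "pot a b W \<le> - 6 + (\<Sum>r\<in>W. 3 * (if r = w then 1 else 0) + 4 * (if r = w then 1 else 0))"
      have "0 \<le> pot a b W" using pot_rest_nonneg[OF u(1) v W(1)] .
      then have "w \<in> W" using W(3) sum_single(2)[of w W] by fastforce
      moreover have "pot a b W \<le> 1" using W(3) sum_single(1)[where w = w and W = W] by linarith
      ultimately show ?thesis using W(1) B by (auto simp: w_def)
    next
      fix \<psi> assume \<psi>: "valid a b (rest u) \<psi>"
        "\<And>r. r \<in> rest u \<Longrightarrow> \<psi> r \<Longrightarrow> cdeg (rest u) \<psi> r \<le> a r - (if r = w then 1 else 0)"
        "\<And>r. r \<in> rest u \<Longrightarrow> \<not> \<psi> r \<Longrightarrow> cdeg (rest u) \<psi> r \<le> b r - (if r = w then 1 else 0)"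
      have slack: "cdeg (rest u) \<psi> w + 1 \<le> cap a b (\<psi> w) w"
        using \<psi>(2,3)[OF w] by (auto simp: cap_def)
      define n1 n2 where "n1 = card {v \<in> link_nb u. \<psi> (other u v)}" and "n2 = card {v \<in> link_nb u. \<not> \<psi> (other u v)}"
      have n: "int n1 + int n2 = b u + 3"
        using card_link_split[of u "\<lambda>v. \<psi> (other u v)"] k by (simp add: n1_def n2_def)
      have "\<not> int n1 \<le> b u"
        using no_extension_plain[OF u(1) \<psi>(1), of False] B by (auto simp: n1_def cap_def)
      moreover have "\<not> int n2 \<le> 1"
        using no_extension_plain[OF u(1) \<psi>(1), of True] B u(2) by (auto simp: n2_def cap_def)
      ultimately have n12: "int n1 = b u + 1" "int n2 = 2" using n by linarith+
      have False
        using no_extension_slack[OF u(1) \<psi>(1) v, of "\<not> \<psi> w"] slack n12 B u(2)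
        by (cases "\<psi> w") (auto simp: w_def cap_def n1_def n2_def)
      then show ?thesis ..
    qed (use rest_sub u in auto)
  qed
  then obtain X where X: "\<And>v. v \<in> link_nb u \<Longrightarrow> X v \<subseteq> rest u \<and> core_nb u \<subseteq> X v \<and> other u v \<in> X v \<and> pot a b (X v) \<le> 1"
    by metis
  show False
    \<comment> \<open>The case of all links covered holds with equality:
      \<open>(b u + 1) + (5 + 3 * b u) - 4 * (b u + 3) = -6\<close>.\<close>
    by (rule cover_contradiction[OF u(1) _ X]) (use k u B in \<open>auto simp: wt_def algebra_simps\<close>)
qed

text \<open>By counting, a colouring of \<open>rest u\<close> extends to \<open>u\<close> and its links unless \<open>z\<close> has colour
  \<open>True\<close>, all links of \<open>u\<close> lead to colour \<open>True\<close>, and all these vertices are saturated.\<close>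

lemma tight_link_core_extension:
  assumes u: "u \<in> V" "a u = 1" "0 \<le> b u" and z: "core_nb u = {z}" and k: "int (card (link_nb u)) = b u + 1"
    and \<psi>: "valid a b (rest u) \<psi>" and sz: "\<not> \<psi> z \<Longrightarrow> cdeg (rest u) \<psi> z + 1 \<le> b z"
  shows "\<psi> z" and "cdeg (rest u) \<psi> z + 1 \<le> a z \<Longrightarrow> False"
    and "v \<in> link_nb u \<Longrightarrow> \<psi> (other u v)"
    and "v \<in> link_nb u \<Longrightarrow> cdeg (rest u) \<psi> (other u v) + 1 \<le> a (other u v) \<Longrightarrow> False"
proof -
  define n1 n2 where "n1 = card {v \<in> link_nb u. \<psi> (other u v)}" and "n2 = card {v \<in> link_nb u. \<not> \<psi> (other u v)}"
  have n: "int n1 + int n2 = b u + 1"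
    using card_link_split[of u "\<lambda>v. \<psi> (other u v)"] k by (simp add: n1_def n2_def)
  have Bt: "{x \<in> core_nb u. \<psi> x = i} = (if \<psi> z = i then {z} else {})" for i
    using z by auto
  have F: "\<not> (if \<psi> z then 0 else 1) + int n1 \<le> b u"
    using no_extension_plain[OF u(1) \<psi>, of False] sz z unfolding Bt
    by (auto simp: n1_def cap_def)
  have T: "\<not> int n2 \<le> 1" if "\<not> \<psi> z"
    using no_extension_plain[OF u(1) \<psi>, of True] that z u(2) unfolding Bt
    by (auto simp: n2_def cap_def)
  show zc: "\<psi> z"
    using F T n by (cases "\<psi> z") auto
  then have "n2 = 0" "int n1 = b u + 1" using F n by auto
  then have e: "{v \<in> link_nb u. \<not> \<psi> (other u v)} = {}"
    using nb_V_split(3)[of u] by (simp add: n2_def)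
  then show all: "\<psi> (other u v)" if "v \<in> link_nb u" for v using that by blast
  show False if "cdeg (rest u) \<psi> z + 1 \<le> a z"
    using no_extension_plain[OF u(1) \<psi>, of True] that z u(2) zc \<open>n2 = 0\<close> unfolding Bt
    by (auto simp: n2_def cap_def)
  show False if "v \<in> link_nb u" "cdeg (rest u) \<psi> (other u v) + 1 \<le> a (other u v)"
    using no_extension_slack[OF u(1) \<psi> that(1), of False] all[OF that(1)] that(2) z zc \<open>int n1 = b u + 1\<close>
    unfolding Bt by (auto simp: n1_def cap_def)
qed

text \<open>The covering sets must contain both \<open>z\<close> and the end of a link. Asking for
  slack at both places at once could produce a set around only one of them, so a set
  \<open>S\<close> of potential at most 1 around \<open>z\<close> is found first, and each end
  outside \<open>S\<close> is attached to it at a cost of at most -6 + 7 = 1.\<close>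

lemma no_tight_link_core:
  assumes u: "u \<in> V" "a u = 1" "2 \<le> b u" and z: "core_nb u = {z}" and k: "int (card (link_nb u)) = b u + 1"
  shows False
proof -
  have b0: "0 \<le> b u" using u(3) by simp
  note ext = tight_link_core_extension[OF u(1,2) b0 z k]
  have zr: "z \<in> rest u" using nb_V_split(5)[OF u(1)] z by auto
  obtain v0 where v0: "v0 \<in> link_nb u" using k u(3) by (cases "link_nb u = {}") auto
  have sub: "rest u \<subseteq> V" "rest u \<noteq> V" using rest_sub u(1) by auto
  obtain S where S: "S \<subseteq> rest u" "z \<in> S" "pot a b S \<le> 1"
  proof (rule lower_caps[of "rest u" "\<lambda>x. if x = z then 1 else 0" "\<lambda>x. if x = z then 1 else 0"])
    fix W assume W: "W \<subseteq> rest u" "W \<noteq> {}"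
      "pot a b W \<le> - 6 + (\<Sum>r\<in>W. 3 * (if r = z then 1 else 0) + 4 * (if r = z then 1 else 0))"
    have "0 \<le> pot a b W" using pot_rest_nonneg[OF u(1) v0 W(1)] .
    then have "z \<in> W" using W(3) sum_single(2)[of z W] by fastforce
    moreover have "pot a b W \<le> 1" using W(3) sum_single(1)[where w = z and W = W] by linarith
    ultimately show thesis using that W(1) by blast
  next
    fix \<psi> assume \<psi>: "valid a b (rest u) \<psi>"
      "\<And>r. r \<in> rest u \<Longrightarrow> \<psi> r \<Longrightarrow> cdeg (rest u) \<psi> r \<le> a r - (if r = z then 1 else 0)"
      "\<And>r. r \<in> rest u \<Longrightarrow> \<not> \<psi> r \<Longrightarrow> cdeg (rest u) \<psi> r \<le> b r - (if r = z then 1 else 0)"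
    have "\<not> \<psi> z \<Longrightarrow> cdeg (rest u) \<psi> z + 1 \<le> b z" using \<psi>(3)[OF zr] by simp
    from ext(1)[OF \<psi>(1) this] ext(2)[OF \<psi>(1) this] \<psi>(2)[OF zr] show thesis by simp
  qed (use sub in auto)
  have SV: "S \<subseteq> V" using S(1) sub by blast
  \<comment> \<open>Slack in colour \<open>False\<close> alone costs 3 and cannot be refused, as -6
    + 3 is negative.\<close>
  obtain \<phi> where \<phi>: "valid a b S \<phi>" "\<not> \<phi> z \<Longrightarrow> cdeg S \<phi> z \<le> b z - 1"
  proof (rule lower_caps[of S "\<lambda>_. 0" "\<lambda>x. if x = z then 1 else 0"])
    fix W assume W: "W \<subseteq> S" "W \<noteq> {}" "pot a b W \<le> - 6 + (\<Sum>r\<in>W. 3 * (if r = z then 1 else 0) + 4 * 0)"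
    have "(\<Sum>r\<in>W. 3 * (if r = z then 1 else 0) + 4 * 0 :: int) \<le> 3"
      using finite_subset[OF W(1) finite_sub[OF SV]] by (simp add: sum_distrib_left[symmetric])
    moreover have "0 \<le> pot a b W" using pot_rest_nonneg[OF u(1) v0, of W] W(1) S(1) by blast
    ultimately show thesis using W(3) by linarith
  next
    fix \<psi> assume "valid a b S \<psi>"
      "\<And>r. r \<in> S \<Longrightarrow> \<not> \<psi> r \<Longrightarrow> cdeg S \<psi> r \<le> b r - (if r = z then 1 else 0)"
    then show thesis using that[of \<psi>] S(2) by force
  qed (use SV S sub in auto)
  have "\<exists>X. X \<subseteq> rest u \<and> core_nb u \<subseteq> X \<and> other u v \<in> X \<and> pot a b X \<le> 2" if v: "v \<in> link_nb u" for v
  proof (cases "other u v \<in> S")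
    case True
    then show ?thesis using S z by (intro exI[of _ S]) auto
  next
    case False
    define w where "w = other u v"
    have w: "w \<in> rest u - S" using link_nb_other(2)[OF v u(1)] False by (simp add: w_def)
    define T where "T = rest u - S"
    have ST: "S \<union> T = rest u" "S \<inter> T = {}" using S(1) by (auto simp: T_def)
    have nonneg: "0 \<le> pot a b (S \<union> W)" if "W \<subseteq> T" for W
      using pot_rest_nonneg[OF u(1) v] that ST by blast
    show ?thesis
    proof (rule extend_or_enlarge[OF SV \<phi>(1), of T "\<lambda>x. if x = w then 1 else 0" "\<lambda>x. if x = w then 1 else 0"])
      fix W assume W: "W \<subseteq> T" and le: "pot a b (S \<union> W) \<le> pot a b S - 6
          + (\<Sum>r\<in>W. 3 * (if r = w then 1 else 0) + 4 * (if r = w then 1 else 0))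
          - int (card {r \<in> W. att S \<phi> True r})"
      then have "w \<in> W" using nonneg[OF W] S(3) sum_single(2)[of w W] by fastforce
      moreover have "pot a b (S \<union> W) \<le> 2" using le S(3) sum_single(1)[where w = w and W = W] by linarith
      ultimately show ?thesis using S W ST z by (intro exI[of _ "S \<union> W"]) (auto simp: w_def)
    next
      fix c N' assume st: "insert c N' \<subseteq> T" "c \<notin> N'" "N' \<subseteq> nb T c"
        "int (card N') = lower S \<phi> True a (\<lambda>x. if x = w then 1 else 0) c + 1"
        "\<And>r. r \<in> insert c N' \<Longrightarrow> lower S \<phi> False b (\<lambda>x. if x = w then 1 else 0) r = -1 \<and> (if r = w then 1 else 0) = (0::int)"
      have "pot a b (S \<union> insert c N') \<le> pot a b S - 3"
        by (rule star_pot[OF SV _ st(2-4)]) (use st(1,5) sub in \<open>auto simp: T_def\<close>)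
      then show ?thesis using nonneg[OF st(1)] S(3) by simp
    next
      fix \<psi> assume "valid (lower S \<phi> True a (\<lambda>x. if x = w then 1 else 0)) (lower S \<phi> False b (\<lambda>x. if x = w then 1 else 0)) T \<psi>"
      note g = glue[OF \<phi>(1) ST(2) this, unfolded ST(1)]
      define \<chi> where "\<chi> = (\<lambda>x. if x \<in> S then \<phi> x else \<psi> x)"
      have \<chi>: "valid a b (rest u) \<chi>" using g(1) by (simp add: \<chi>_def)
      \<comment> \<open>Glueing does not change the degree of \<open>z\<close>, so its slack in
        \<phi> survives.\<close>
      have "cdeg (rest u) \<chi> z = cdeg S \<phi> z" using g(2)[of z] S(2) by (simp add: \<chi>_def)
      then have sz: "\<not> \<chi> z \<Longrightarrow> cdeg (rest u) \<chi> z + 1 \<le> b z" using \<phi>(2) S(2) by (simp add: \<chi>_def)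
      have "\<chi> w" using ext(3)[OF \<chi> sz v] by (simp add: w_def)
      then have "\<psi> w" using w by (simp add: \<chi>_def)
      then have "cdeg (rest u) \<chi> w \<le> a w - 1" using g(3)[of w] w by (simp add: \<chi>_def T_def)
      then show ?thesis using ext(4)[OF \<chi> sz v] by (simp add: w_def)
    qed (use ST sub in \<open>auto simp: T_def\<close>)
  qed
  then obtain X where X: "\<And>v. v \<in> link_nb u \<Longrightarrow> X v \<subseteq> rest u \<and> core_nb u \<subseteq> X v \<and> other u v \<in> X v \<and> pot a b (X v) \<le> 2"
    by metis
  show False
    \<comment> \<open>The three numbers are \<open>b u - 6\<close>, \<open>b u - 10\<close> and
      \<open>b u - 4\<close>; \<open>2 \<le> b u\<close> provides the three links.\<close>
    by (rule cover_contradiction[OF u(1) _ X]) (use k u z caps_bounds[OF u(1)] in \<open>auto simp: wt_def algebra_simps\<close>)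
qed

section \<open>Vertices of small capacity\<close>

text \<open>Without edges between them, colourings of \<open>S\<close> and of \<open>V - S\<close>
  could simply be put together.\<close>

lemma connected:
  assumes "S \<subseteq> V" "S \<noteq> {}" "S \<noteq> V" shows "\<exists>r\<in>V - S. nb S r \<noteq> {}"
proof (rule ccontr)
  assume no: "\<not> ?thesis"
  obtain \<phi> where \<phi>: "valid a b S \<phi>" using col_proper assms by (auto simp: col_def)
  obtain \<psi> where \<psi>: "valid a b (V - S) \<psi>" using col_proper[of "V - S"] assms by (auto simp: col_def)
  have "lower S \<phi> i c (\<lambda>_. 0) r = max (-1) (c r)" if "r \<in> V - S" for i c r
    using no that by (auto simp: lower_def att_def nb_def)
  then have "valid (lower S \<phi> True a (\<lambda>_. 0)) (lower S \<phi> False b (\<lambda>_. 0)) (V - S) \<psi>"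
    using \<psi> by (auto simp: valid_def cap_def le_max_iff_disj split: if_splits)
  from glue(1)[OF \<phi> _ this] have "col a b V" using assms(1) by (auto simp: col_def Un_absorb1)
  then show False using not_col by simp
qed

text \<open>\<open>S\<close> forbids only \<open>True\<close>, so the vertices of a star outcome
  have \<open>b r = -1\<close> from the start. By \<open>free\<close> the centre has no neighbour in
  \<open>S\<close> and keeps its capacity; the star would make \<open>V\<close> overfull.\<close>

lemma extend_from_True:
  assumes S: "S \<subseteq> V" "valid a b S (\<lambda>_. True)" and T: "T \<subseteq> V" "S \<inter> T = {}" "T \<noteq> V"
    and nonneg: "\<And>r. 0 \<le> \<beta> r" and free: "\<And>r. r \<in> T \<Longrightarrow> b r = -1 \<Longrightarrow> nb S r = {}"
  obtains
    (extend) \<psi> where "valid (lower S (\<lambda>_. True) True a (\<lambda>_. 0)) (lower S (\<lambda>_. True) False b \<beta>) T \<psi>"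
  | (enlarge) W where "W \<subseteq> T" "W \<noteq> {}"
      "pot a b (S \<union> W) \<le> pot a b S - 6 + 3 * (\<Sum>r\<in>W. \<beta> r) - int (card {r \<in> W. nb S r \<noteq> {}})"
proof (rule extend_or_enlarge[OF S T, of "\<lambda>_. 0" \<beta>])
  fix W assume "W \<subseteq> T" "W \<noteq> {}" "pot a b (S \<union> W) \<le> pot a b S - 6 + (\<Sum>r\<in>W. 3 * \<beta> r + 4 * 0)
      - int (card {r \<in> W. att S (\<lambda>_. True) True r})"
  then show thesis using enlarge[of W] by (simp add: att_True sum_distrib_left)
next
  fix v N' assume st: "insert v N' \<subseteq> T" "N' \<subseteq> nb T v"
    "int (card N') = lower S (\<lambda>_. True) True a (\<lambda>_. 0) v + 1"
    "\<And>r. r \<in> insert v N' \<Longrightarrow> lower S (\<lambda>_. True) False b \<beta> r = -1 \<and> \<beta> r = 0"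
  have cb: "-1 \<le> a r" "-1 \<le> b r" if "r \<in> insert v N'" for r
    using that st(1) T(1) caps_bounds[of r] by auto
  have br: "b r = -1" if "r \<in> insert v N'" for r
    using st(4)[OF that] cb[OF that] by (auto simp: lower_def att_def max_def split: if_splits)
  then have "nb S v = {}" using free[of v] st(1) by simp
  then have "int (card N') = a v + 1"
    using st(3) cb[of v] by (simp add: lower_def att_True)
  moreover have "N' \<subseteq> {r \<in> nb V v. b r = -1}"
    using st(2) br nb_mono[OF T(1)] by blast
  then have "card N' \<le> card {r \<in> nb V v. b r = -1}"
    using finV by (intro card_mono) auto
  ultimately have "overfull a b V"
    using br[of v] st(1) T(1) by (force simp: overfull_def)
  then show thesis using not_overfull by blast
qed (use nonneg extend in auto)

text \<open>An enlargement has potential at most 1 - 6 = -5 and hence is \<open>V\<close>. By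
  connectivity \<open>True\<close> was forbidden somewhere, and the 1 saved there brings the
  potential of \<open>V\<close> to -6.\<close>

lemma True_start_impossible:
  assumes S: "S \<subseteq> V" "S \<noteq> {}" "valid a b S (\<lambda>_. True)" "pot a b S \<le> 1"
    and free: "\<And>r. r \<in> V - S \<Longrightarrow> b r = -1 \<Longrightarrow> nb S r = {}"
  shows False
proof -
  have SV: "S \<noteq> V" using S(3) not_col by (auto simp: col_def)
  show False
  proof (rule extend_from_True[OF S(1,3), of "V - S" "\<lambda>_. 0"])
    fix \<psi> assume "valid (lower S (\<lambda>_. True) True a (\<lambda>_. 0)) (lower S (\<lambda>_. True) False b (\<lambda>_. 0)) (V - S) \<psi>"
    from glue(1)[OF S(3) _ this] have "col a b V" using S(1) by (auto simp: col_def Un_absorb1)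
    then show False using not_col by simp
  next
    fix W assume W: "W \<subseteq> V - S" and le: "pot a b (S \<union> W) \<le> pot a b S - 6 + 3 * (\<Sum>r\<in>W. 0) - int (card {r \<in> W. nb S r \<noteq> {}})"
    have "S \<union> W = V"
      using pot_ge[of "S \<union> W"] W S(1,4) le by fastforce
    then have "W = V - S" using W by blast
    then have "{r \<in> W. nb S r \<noteq> {}} \<noteq> {}" using connected[OF S(1,2) SV] by blast
    then have "1 \<le> card {r \<in> W. nb S r \<noteq> {}}"
      using \<open>W = V - S\<close> finV by (simp add: Suc_leI card_gt_0_iff)
    then show False using le S(4) pot_V \<open>S \<union> W = V\<close> by simp
  qed (use S SV free in auto)
qed

section \<open>Vertices restricted to colour \<open>True\<close>\<close>

lemma forced_a:
  assumes u: "u \<in> V" "b u = -1" shows "a u = 1"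
proof (rule ccontr)
  assume "a u \<noteq> 1"
  moreover have "a u \<noteq> -1"
    using u not_overfull by (force simp: overfull_def)
  ultimately have a0: "a u = 0" using caps_bounds[OF u(1)] by linarith
  show False
  \<comment> \<open>With \<open>a u = 0\<close> the single vertex weighs only 1; a neighbour with
    \<open>b r = -1\<close> would make \<open>V\<close> overfull.\<close>
  proof (rule True_start_impossible[of "{u}"])
    show "valid a b {u} (\<lambda>_. True)" using a0 by (simp add: valid_def cap_def cdeg_def)
    show "pot a b {u} \<le> 1" using a0 u by (simp add: wt_def)
    show "nb {u} r = {}" if "r \<in> V - {u}" "b r = -1" for r
    proof (rule ccontr)
      assume "nb {u} r \<noteq> {}"
      then have "r \<in> {r \<in> nb V u. b r = -1}" using that by (auto simp: nb_def dest: adj_sym)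
      then have "1 \<le> card {r \<in> nb V u. b r = -1}" using finV by (auto simp: Suc_le_eq card_gt_0_iff)
      then show False using u a0 not_overfull by (force simp: overfull_def)
    qed
  qed (use u in auto)
qed

text \<open>The two vertices, both \<open>True\<close>, would be a start of potential 5 + 5 - 9 =
  1.\<close>

lemma forced_indep:
  assumes u: "u \<in> V" "b u = -1" "u' \<in> V" "b u' = -1" shows "\<not> adj u u'"
proof
  assume adj: "adj u u'"
  then have ne: "u \<noteq> u'" using adj_irrefl by auto
  note a1 = forced_a[OF u(1,2)] forced_a[OF u(3,4)]
  have two: False if "x \<in> V" "b x = -1" "a x = 1" "y \<in> V" "z \<in> V" "y \<noteq> z" "adj x y" "adj x z" "b y = -1" "b z = -1" for x y z
  proof -
    have "card {y, z} \<le> card {r \<in> nb V x. b r = -1}"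
      using that finV by (intro card_mono) (auto simp: nb_def)
    then show False using that not_overfull by (force simp: overfull_def)
  qed
  show False
  proof (rule True_start_impossible[of "{u, u'}"])
    have "nb {u, u'} u = {u'}" "nb {u, u'} u' = {u}"
      using adj adj_sym by (auto simp: nb_def adj_irrefl)
    then show "valid a b {u, u'} (\<lambda>_. True)" using a1 by (simp add: valid_def cap_def cdeg_def)
    have "nb {u'} u = {u'}" using adj by (auto simp: nb_def)
    then show "pot a b {u, u'} \<le> 1"
      using pot_insert[of "{u'}" u a b] a1 u ne by (simp add: wt_def)
    show "nb {u, u'} r = {}" if "r \<in> V - {u, u'}" "b r = -1" for r
    proof (rule ccontr)
      assume "nb {u, u'} r \<noteq> {}"
      then have "adj u r \<or> adj u' r" using adj_sym by (auto simp: nb_def)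
      then show False
        using two[of u r u'] two[of u' r u] that u a1 adj adj_sym by auto
    qed
  qed (use u in auto)
qed

text \<open>Slack in colour \<open>True\<close> at the only neighbour \<open>z\<close> would allow
  \<open>u\<close> to be \<open>True\<close>. It costs 4 and cannot be refused, since -6 + 4 lies
  below -1.\<close>

lemma forced_not_leaf:
  assumes u: "u \<in> V" "b u = -1" shows "card (nb V u) \<noteq> 1"
proof
  assume "card (nb V u) = 1"
  then obtain z where z: "nb V u = {z}" by (auto simp: card_1_singleton_iff)
  have a1: "a u = 1" by (rule forced_a[OF u])
  have uL: "u \<notin> links" using u by (auto simp: links_def)
  have card1: "card (link_nb u) + card (core_nb u) = 1" using card_nb_V[of u] z by simp
  have "core_nb u \<noteq> {}"
  proof
    assume "core_nb u = {}"
    obtain n1 n2 m1 m2 where "n1 + n2 = card (link_nb u)" "m1 + m2 = card (core_nb u)"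
      "1 \<le> m1 \<or> a u + 1 \<le> int n2"
      using core_degree[OF u(1) uL] by metis
    then show False using card1 a1 \<open>core_nb u = {}\<close> by simp
  qed
  then have B: "core_nb u = {z}" "link_nb u = {}"
  proof -
    have "core_nb u \<subseteq> {z}" "link_nb u \<subseteq> {z}" using nb_V_split(1)[of u] z by blast+
    then show "core_nb u = {z}" "link_nb u = {}"
      using \<open>core_nb u \<noteq> {}\<close> nb_V_split(2)[of u] by blast+
  qed
  have rest: "rest u = V - {u}" using B by (simp add: rest_def)
  have zV: "z \<in> V - {u}" "adj u z" using z by (auto simp: nb_def adj_irrefl)
  show False
  \<comment> \<open>\<open>lower_caps\<close> does not cover a reduction of \<open>a\<close> alone.
    In the star outcome, \<open>forced_indep\<close> keeps \<open>z\<close> from being the centre,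
    so the centre has its original capacity.\<close>
  proof (rule extend_or_enlarge[of "{}" "\<lambda>_. True" "V - {u}" "\<lambda>x. if x = z then 1 else 0" "\<lambda>_. 0"])
    show "valid a b {} (\<lambda>_. True)" by (simp add: valid_def)
    fix W assume W: "W \<subseteq> V - {u}" "W \<noteq> {}" and le: "pot a b ({} \<union> W) \<le> pot a b {} - 6
      + (\<Sum>r\<in>W. 3 * 0 + 4 * (if r = z then 1 else 0)) - int (card {r \<in> W. att {} (\<lambda>_. True) True r})"
    have "(\<Sum>r\<in>W. 3 * 0 + 4 * (if r = z then 1 else 0) :: int) \<le> 4"
    proof -
      have "finite W" using W(1) finV finite_subset by blast
      then show ?thesis by (simp add: sum_distrib_left[symmetric])
    qed
    then show False using le pot_ge[of W] W u(1) by fastforce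
  next
    fix v N' assume st: "insert v N' \<subseteq> V - {u}" "N' \<subseteq> nb (V - {u}) v"
      "int (card N') = lower {} (\<lambda>_. True) True a (\<lambda>x. if x = z then 1 else 0) v + 1"
      "\<And>r. r \<in> insert v N' \<Longrightarrow> lower {} (\<lambda>_. True) False b (\<lambda>_. 0) r = -1 \<and> (0::int) = 0"
    have br: "b r = -1" if "r \<in> insert v N'" for r
      using st(4)[OF that] caps_bounds[of r] that st(1) by (auto simp: lower_def att_def max_def split: if_splits)
    have "v \<noteq> z" using forced_indep[OF u, of z] br[of v] zV by auto
    then have "int (card N') = a v + 1"
      using st(3) caps_bounds[of v] st(1) by (simp add: lower_def att_def)
    moreover have "N' \<subseteq> {r \<in> nb V v. b r = -1}"
      using st(2) br by (auto simp: nb_def)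
    then have "card N' \<le> card {r \<in> nb V v. b r = -1}"
      using finV by (intro card_mono) auto
    ultimately have "overfull a b V"
      using br[of v] st(1) by (force simp: overfull_def)
    then show False using not_overfull by blast
  next
    fix \<psi> assume low: "valid (lower {} (\<lambda>_. True) True a (\<lambda>x. if x = z then 1 else 0)) (lower {} (\<lambda>_. True) False b (\<lambda>_. 0)) (V - {u}) \<psi>"
    have "valid a b (rest u) \<psi>"
      using cdeg_empty_lower(1)[OF low] rest by simp
    moreover have "cdeg (rest u) \<psi> z + 1 \<le> a z" if "\<psi> z"
      using lower_validD(1)[OF low zV(1) that] rest by simp
    ultimately show False
      using no_extension_plain[OF u(1), of \<psi> True] B a1 by (cases "\<psi> z") (auto simp: cap_def Collect_conv_if)
  qed (use u in auto)
qed

text \<open>\<open>u\<close> is \<open>True\<close> and its capacity 1 is reserved for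
  \<open>v0\<close>. All other links may then be \<open>False\<close>, at the expense of one unit of
  \<open>b\<close> at their other ends. Such a unit costs 3, but adding the link to the enlarged set
  lowers its potential by 4.\<close>

lemma no_link_at_low:
  assumes u: "u \<in> V" "a u = 1" "b u \<le> 0" and v0: "v0 \<in> link_nb u" and deg: "2 \<le> card (nb V u)"
    and free: "\<And>r. r \<in> nb V u \<Longrightarrow> b r \<noteq> -1"
  shows False
proof -
  define E where "E = link_nb u - {v0}"
  have finE: "finite E" using nb_V_split(3) by (simp add: E_def)
  have wt5: "wt (a u) (b u) = 5" using u by (simp add: wt_def)
  have potu: "pot a b {u} = 5" using wt5 by simp
  show False
  proof (rule extend_from_True[of "{u}" "rest u" "\<lambda>x. int (card {v \<in> E. other u v = x})"])
    show "valid a b {u} (\<lambda>_. True)" using u by (simp add: valid_def cap_def cdeg_def)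
    show "nb {u} r = {}" if "r \<in> rest u" "b r = -1" for r
      using free[of r] that rest_sub(1)[of u] by (auto simp: nb_def dest: adj_sym)
    fix \<psi> assume low: "valid (lower {u} (\<lambda>_. True) True a (\<lambda>_. 0))
      (lower {u} (\<lambda>_. True) False b (\<lambda>x. int (card {v \<in> E. other u v = x}))) (rest u) \<psi>"
    note lowD = lower_validD[OF low]
    have valid: "valid a b (rest u) \<psi>"
      using lowD(1,2) by (force simp: valid_def cap_def)
    have B: "\<not> \<psi> z" if "z \<in> core_nb u" for z
    proof
      assume "\<psi> z"
      have "z \<in> rest u" "adj z u" using that nb_V_split(5)[OF u(1)] by (auto simp: core_nb_def nb_def dest: adj_sym)
      then show False using lowD(3)[of z] \<open>\<psi> z\<close> by (auto simp: att_def)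
    qed
    then have Be: "{z \<in> core_nb u. \<psi> z = True} = {}" by auto
    have "{v \<in> link_nb u. \<psi> (other u v) \<noteq> True \<and> v \<notin> E} \<subseteq> {v0}" by (auto simp: E_def)
    then have "card {v \<in> link_nb u. \<psi> (other u v) \<noteq> True \<and> v \<notin> E} \<le> 1"
      using card_mono[of "{v0}"] by fastforce
    then have h1: "int (card {z \<in> core_nb u. \<psi> z = True}) + int (card {v \<in> link_nb u. \<psi> (other u v) \<noteq> True \<and> v \<notin> E}) \<le> cap a b True u"
      unfolding Be using u(2) by (simp add: cap_def)
    have fib: "{v \<in> link_nb u. v \<in> E \<and> other u v = x} = {v \<in> E. other u v = x}" for x
      by (auto simp: E_def)
    show False
    proof (rule no_extension[OF u(1) valid h1])
      show "cdeg (rest u) \<psi> z + 1 \<le> cap a b True z" if "z \<in> core_nb u" "\<psi> z = True" for z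
        using B that by blast
      show "cdeg (rest u) \<psi> x + int (card {v \<in> link_nb u. v \<in> E \<and> other u v = x}) \<le> cap a b (\<psi> x) x"
        if "x \<in> rest u" "\<psi> x \<noteq> True" for x
        using lowD(2)[OF that(1)] that(2) unfolding fib by (simp add: cap_def)
    qed
  next
    fix W assume W: "W \<subseteq> rest u" "W \<noteq> {}" and le: "pot a b ({u} \<union> W) \<le> pot a b {u} - 6
      + 3 * (\<Sum>r\<in>W. int (card {v \<in> E. other u v = r})) - int (card {r \<in> W. nb {u} r \<noteq> {}})"
    have finW: "finite W" using W(1) rest_sub finite_sub by blast
    define M where "M = {v \<in> link_nb u. other u v \<in> W}"
    define Y where "Y = insert u W \<union> M"
    have finM: "finite M" using nb_V_split(3) by (simp add: M_def)
    define g where "g = card {r \<in> W. nb {u} r \<noteq> {}}"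
    have "{v \<in> link_nb u. other u v \<in> insert u W} = M"
      using link_nb_other(3)[OF _ u(1)] by (auto simp: M_def)
    moreover have iW: "insert u W \<subseteq> V" "insert u W \<inter> link_nb u = {}"
      using W(1) u(1) link_nb_other(5)[OF _ u(1)] by (auto simp: rest_def)
    ultimately have "pot a b Y = pot a b (insert u W) - 4 * int (card M)"
      using pot_add_links[OF u(1), of "insert u W"] by (simp add: Y_def)
    moreover have "(\<Sum>r\<in>W. int (card {v \<in> E. other u v = r})) = int (card (M - {v0}))"
    proof -
      have "{v \<in> E. other u v \<in> W} = M - {v0}" by (auto simp: E_def M_def)
      then show ?thesis using sum_card_fibres[OF finE finW, of "other u"] by simp
    qed
    ultimately have potY: "pot a b Y \<le> -1 + 3 * int (card (M - {v0})) - 4 * int (card M) - int g"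
      using le potu by (simp add: g_def)
    have "card (M - {v0}) \<le> card M" using finM by (simp add: card_mono)
    have YV: "Y \<subseteq> V" using iW by (auto simp: Y_def M_def link_nb_def links_def)
    \<comment> \<open>For \<open>Y = V\<close> the bound becomes \<open>-4 - card (nb V u)\<close>,
      at most -6. Otherwise \<open>M\<close> and \<open>g\<close> vanish, so \<open>Y\<close> misses
      all of the at least two neighbours of \<open>u\<close>, and potential -1 is too small.\<close>
    show False
    proof (cases "Y = V")
      case True
      have "link_nb u \<subseteq> M"
        using True iW(2) by (auto simp: Y_def link_nb_def links_def)
      then have M_eq: "M = link_nb u" by (auto simp: M_def)
      have "core_nb u \<subseteq> {r \<in> W. nb {u} r \<noteq> {}}"
      proof
        fix r assume r: "r \<in> core_nb u"
        then have "r \<in> rest u" using nb_V_split(5)[OF u(1)] by blast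
        then have "r \<in> Y" "r \<noteq> u" "r \<notin> link_nb u" using True by (auto simp: rest_def)
        then have "r \<in> W" by (simp add: Y_def M_eq)
        moreover have "u \<in> nb {u} r" using r by (auto simp: core_nb_def nb_def dest: adj_sym)
        ultimately show "r \<in> {r \<in> W. nb {u} r \<noteq> {}}" by blast
      qed
      then have "card (core_nb u) \<le> g"
        unfolding g_def using finW by (intro card_mono) auto
      moreover have "int (card (M - {v0})) = int (card (link_nb u)) - 1"
        using v0 nb_V_split(3)[of u] card_Suc_Diff1[OF _ v0] by (simp add: M_eq)
      moreover have "card M = card (link_nb u)" "-5 \<le> pot a b Y" using M_eq pot_V True by simp_all
      ultimately show False
        using potY deg card_nb_V[of u] by linarith
    next
      case False
      then have ge: "-1 \<le> pot a b Y" using pot_ge YV by blast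
      then have "card M = 0" "g = 0" using potY \<open>card (M - {v0}) \<le> card M\<close> by linarith+
      then have "M = {}" and g0: "{r \<in> W. nb {u} r \<noteq> {}} = {}" using finM finW by (auto simp: g_def)
      have out: "r \<notin> Y" if "r \<in> nb V u" for r
        using that g0 \<open>M = {}\<close> by (auto simp: Y_def nb_def adj_irrefl dest: adj_sym)
      have "\<not> card (nb V u) \<le> 1" using deg by simp
      then obtain x y where "x \<in> nb V u" "y \<in> nb V u" "x \<noteq> y"
        using card_le_Suc0_iff_eq[of "nb V u"] finV by auto
      then have "0 \<le> pot a b Y" using pot_nonneg[OF YV, of x y] out by (auto simp: nb_def)
      then show False using potY \<open>card M = 0\<close> \<open>M = {}\<close> by simp
    qed
  qed (use u rest_sub in auto)
qed

section \<open>Discharging\<close>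

text \<open>A link contributes \<open>14 - 2 * 9 = -4\<close> to the potential, shared equally by its two neighbours;
  all charges are doubled.\<close>

definition charge :: "'a \<Rightarrow> int" where
  "charge u = 2 * wt (a u) (b u) - 4 * int (card (link_nb u)) - 9 * int (card (core_nb u))"

lemma sum_charge: "(\<Sum>u\<in>V - links. charge u) = 2 * pot a b V"
proof -
  define Y where "Y = V - links"
  have fin: "finite Y" "finite links" using finV by (auto simp: Y_def links_def)
  have YV: "Y \<union> links = V" "Y \<inter> links = {}" by (auto simp: Y_def links_def)
  have two: "card (nb Y v) = 2" if "v \<in> links" for v
  proof -
    have "nb Y v = nb V v" using links_indep[OF that] by (auto simp: Y_def nb_def)
    then show ?thesis using that by (simp add: links_def)
  qed
  have "edges_in links = {}" using links_indep by (auto simp: edges_in_def)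
  then have "pot a b links = (\<Sum>v\<in>links. 14)"
    unfolding pot_def by (simp add: links_def wt_def)
  moreover have "pot a b V = pot a b Y + pot a b links - 9 * (\<Sum>r\<in>links. int (card (nb Y r)))"
    using pot_Un[OF fin YV(2), of a b] YV(1) by simp
  ultimately have V: "pot a b V = pot a b Y - 4 * int (card links)"
    using two by simp
  have "(\<Sum>u\<in>Y. int (card (nb links u))) = 2 * int (card links)"
    using sum_card_nb[OF fin(2,1)] two by simp
  moreover have "nb links u = link_nb u" "nb Y u = core_nb u" for u
    by (auto simp: nb_def link_nb_def core_nb_def Y_def)
  ultimately have "(\<Sum>u\<in>Y. charge u) = 2 * pot a b Y - 8 * int (card links)"
    using handshake[OF fin(1)]
    by (simp add: charge_def pot_def sum_subtractf flip: sum_distrib_left)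
  then show ?thesis using V by (simp add: Y_def)
qed

section \<open>Bounds for the charges\<close>

lemma forced_vertex:
  assumes u: "u \<in> V" "b u = -1" shows "a u = 1" "link_nb u = {}" "2 \<le> card (core_nb u)"
proof -
  show a1: "a u = 1" by (rule forced_a[OF u])
  have "u \<notin> links" using u by (auto simp: links_def)
  then obtain n1 n2 m1 m2 where "n1 + n2 = card (link_nb u)" "m1 + m2 = card (core_nb u)" "1 \<le> m1 \<or> a u + 1 \<le> int n2"
    using core_degree[OF u(1)] by metis
  then have deg: "2 \<le> card (nb V u)"
    using forced_not_leaf[OF u] a1 card_nb_V[of u] by auto
  show "link_nb u = {}"
  proof (rule ccontr)
    assume "link_nb u \<noteq> {}"
    then obtain v where "v \<in> link_nb u" by blast
    then show False
      using no_link_at_low[OF u(1) a1 _ _ deg] u forced_indep[OF u] by (auto simp: nb_def)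
  qed
  then show "2 \<le> card (core_nb u)" using deg card_nb_V[of u] by simp
qed

text \<open>With \<open>b u = 0\<close> the vertex alone would be a proper subset of potential
  -3.\<close>

lemma no_negative_vertex:
  assumes "u \<in> V" "a u = -1" shows "1 \<le> b u"
proof (rule ccontr)
  assume "\<not> 1 \<le> b u"
  moreover have "b u \<noteq> -1" using forced_a[OF assms(1)] assms(2) by auto
  ultimately have b0: "b u = 0" using caps_bounds[OF assms(1)] by linarith
  have "u \<notin> links" using assms by (auto simp: links_def)
  then obtain n1 n2 m1 m2 where "n1 + n2 = card (link_nb u)" "m1 + m2 = card (core_nb u)" "b u + 1 \<le> int (n1 + m2)"
    using core_degree[OF assms(1)] by metis
  then have "card (nb V u) \<noteq> 0" using b0 card_nb_V[of u] by auto
  then obtain r where "r \<in> nb V u" by fastforce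
  then have "{u} \<noteq> V" by (auto simp: nb_def adj_irrefl)
  then have "-1 \<le> pot a b {u}" using assms(1) by (intro pot_ge) auto
  then show False using b0 assms(2) by (simp add: wt_def)
qed

text \<open>In case \<open>one\<close>, \<open>core_degree\<close> would still allow
  \<open>k = b u + 3\<close> for \<open>h = 0\<close> and \<open>k = b u + 1\<close> for
  \<open>h = 1\<close>, with charges \<open>2 * b u - 2\<close> and \<open>2 * b u - 3\<close>.
  These are positive for \<open>b u \<ge> 2\<close>, so the tight-link lemmas supply one more
  link.\<close>

lemma charge_cases:
  assumes u: "u \<in> V" "u \<notin> links"
  defines "k \<equiv> int (card (link_nb u))" and "h \<equiv> int (card (core_nb u))"
  obtains (forced) "b u = -1" "a u = 1" "k = 0" "2 \<le> h"
  | (one) "a u = 1" "0 \<le> b u" "b u + 2 \<le> k + h" "h = 0 \<Longrightarrow> b u + 4 \<le> k" "h = 1 \<Longrightarrow> 2 \<le> b u \<Longrightarrow> b u + 2 \<le> k"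
      "charge u = 10 + 6 * b u - 4 * k - 9 * h"
  | (zero) "a u = 0" "0 \<le> b u" "b u + 2 \<le> k + h" "charge u = 2 + 6 * b u - 4 * k - 9 * h"
  | (minus) "a u = -1" "1 \<le> b u" "b u + 1 \<le> k + h" "charge u = -6 + 6 * b u - 4 * k - 9 * h"
proof -
  note c = caps_bounds[OF u(1)]
  obtain n1 n2 m1 m2 where n: "n1 + n2 = card (link_nb u)" "m1 + m2 = card (core_nb u)"
    "b u + 1 \<le> int (n1 + m2)" "1 \<le> m1 \<or> a u + 1 \<le> int n2"
    by (rule core_degree[OF u])
  have ch: "charge u = 2 + 8 * a u + 6 * b u - 4 * k - 9 * h" if "0 \<le> b u"
    using that by (simp add: charge_def wt_def k_def h_def)
  consider "b u = -1" | "0 \<le> b u" "a u = 1" | "0 \<le> b u" "a u = 0" | "a u = -1"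
    using c by linarith
  then show thesis
  proof cases
    case 1
    then show thesis using forced_vertex[OF u(1)] forced by (simp add: k_def h_def)
  next
    case 2
    have d: "b u + 2 \<le> k + h" using n 2 by (auto simp: k_def h_def)
    have h0: "b u + 4 \<le> k" if "h = 0"
    proof -
      have B: "core_nb u = {}" using that nb_V_split(4)[of u] by (simp add: h_def)
      then have "b u + 3 \<le> k" using n 2 by (auto simp: k_def)
      moreover have "k \<noteq> b u + 3" using no_tight_link_star[OF u(1) 2(2,1) B] by (auto simp: k_def)
      ultimately show ?thesis by simp
    qed
    have h1: "b u + 2 \<le> k" if "h = 1" "2 \<le> b u"
    proof -
      have "card (core_nb u) = 1" using that(1) unfolding h_def by linarith
      then obtain z where z: "core_nb u = {z}" by (rule card_1_singletonE)
      have "k \<noteq> b u + 1" unfolding k_def using no_tight_link_core[OF u(1) 2(2) that(2) z] by blast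
      then show ?thesis using d that by simp
    qed
    show thesis using one 2 d h0 h1 ch by simp
  next
    case 3
    have "b u + 2 \<le> k + h" using n 3 by (auto simp: k_def h_def)
    then show thesis using zero 3 ch by simp
  next
    case 4
    have "1 \<le> b u" by (rule no_negative_vertex[OF u(1) 4])
    moreover have "b u + 1 \<le> k + h" using n by (auto simp: k_def h_def)
    ultimately show thesis using minus 4 ch by simp
  qed
qed

lemma charge_forced:
  assumes "u \<in> V" "b u = -1" shows "charge u \<le> -8"
proof -
  have "charge u = 10 - 9 * int (card (core_nb u))"
    unfolding charge_def wt_def forced_vertex(1,2)[OF assms] assms(2) by simp
  then show ?thesis using forced_vertex(3)[OF assms] by linarith
qed

text \<open>The bounds of \<open>charge_cases\<close> reach 0 only for \<open>b u = 3\<close> and no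
  core neighbour.\<close>

lemma charge_le:
  assumes u: "u \<in> V" "u \<notin> links"
  shows "charge u \<le> 0" "core_nb u \<noteq> {} \<Longrightarrow> charge u \<le> -1"
proof -
  note c = caps_bounds[OF u(1)]
  define k h where "k = int (card (link_nb u))" and "h = int (card (core_nb u))"
  have kh: "0 \<le> k" "0 \<le> h" by (auto simp: k_def h_def)
  have "charge u \<le> 0 \<and> (1 \<le> h \<longrightarrow> charge u \<le> -1)"
  proof (rule charge_cases[OF u, folded k_def h_def])
    show ?thesis if "b u = -1" using charge_forced[OF u(1) that] by simp
    assume one: "a u = 1" "0 \<le> b u" "b u + 2 \<le> k + h" "h = 0 \<Longrightarrow> b u + 4 \<le> k" "h = 1 \<Longrightarrow> 2 \<le> b u \<Longrightarrow> b u + 2 \<le> k"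
      "charge u = 10 + 6 * b u - 4 * k - 9 * h"
    consider "h = 0" | "h = 1" | "2 \<le> h" using kh by linarith
    then show ?thesis
    proof cases
      case 2
      then show ?thesis using one c by (cases "2 \<le> b u") auto
    qed (use one c in auto)
  qed (use c kh in auto)
  then show "charge u \<le> 0" "core_nb u \<noteq> {} \<Longrightarrow> charge u \<le> -1"
    using nb_V_split(4)[of u] by (auto simp: h_def card_gt_0_iff Suc_le_eq)
qed

text \<open>-10 is twice the -5 of \<open>pot_V\<close>; the omitted charges are
  nonpositive.\<close>

lemma sum_charge_ge:
  assumes "U \<subseteq> V - links" shows "-10 \<le> (\<Sum>u\<in>U. charge u)"
proof -
  have "(\<Sum>u\<in>V - links. charge u) = (\<Sum>u\<in>U. charge u) + (\<Sum>u\<in>V - links - U. charge u)"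
    using assms finV by (metis add.commute finite_Diff sum.subset_diff)
  moreover have "(\<Sum>u\<in>V - links - U. charge u) \<le> 0"
    using charge_le(1) by (intro sum_nonpos) auto
  ultimately show ?thesis using sum_charge pot_V by simp
qed

text \<open>Every core neighbour of \<open>u\<close> has the core neighbour \<open>u\<close> and
  thus charge at most -1, so \<open>charge u\<close> is at least \<open>h - 10\<close>. This lower
  bound competes with the 9 that each of the more than \<open>b u\<close> core neighbours takes
  away.\<close>

lemma excess_vertex:
  assumes u: "u \<in> V" "u \<notin> links" and over: "b u < int (card (core_nb u))"
  shows "a u = 1" "card (link_nb u) \<le> 1" "charge u \<le> -6"
proof -
  note c = caps_bounds[OF u(1)]
  define k h where "k = int (card (link_nb u))" and "h = int (card (core_nb u))"
  have kh: "0 \<le> k" "0 \<le> h" "b u + 1 \<le> h" using over by (auto simp: k_def h_def)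
  have core: "r \<in> V" "r \<notin> links" "adj u r" "r \<noteq> u" "core_nb r \<noteq> {}" if "r \<in> core_nb u" for r
    using that u by (auto simp: core_nb_def nb_def adj_irrefl dest: adj_sym)
  have "-10 \<le> (\<Sum>r\<in>insert u (core_nb u). charge r)"
    using core u by (intro sum_charge_ge) auto
  also have "\<dots> = charge u + (\<Sum>r\<in>core_nb u. charge r)"
    using nb_V_split(4)[of u] core(4) by (subst sum.insert) auto
  also have "(\<Sum>r\<in>core_nb u. charge r) \<le> (\<Sum>r\<in>core_nb u. -1)"
    using core charge_le(2) by (intro sum_mono) auto
  finally have s: "h - 10 \<le> charge u" by (simp add: h_def)
  have "a u = 1 \<and> k \<le> 1 \<and> charge u \<le> -6"
  proof (rule charge_cases[OF u, folded k_def h_def])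
    show ?thesis if "b u = -1" "a u = 1" "k = 0"
      using that charge_forced[OF u(1)] by simp
    assume one: "a u = 1" "0 \<le> b u" "b u + 2 \<le> k + h" "charge u = 10 + 6 * b u - 4 * k - 9 * h"
    show ?thesis
    proof (cases "b u = 0")
      case b0: True
      \<comment> \<open>A link would make \<open>charge u\<close> at most 10 - 4 - 9 = -3, and
        \<open>no_link_at_low\<close> would yield a neighbour of charge at most -8: together less
        than -10.\<close>
      have "link_nb u = {}"
      proof (rule ccontr)
        assume "link_nb u \<noteq> {}"
        then obtain v where v: "v \<in> link_nb u" by blast
        have deg: "2 \<le> card (nb V u)" using one b0 card_nb_V[of u] by (simp add: k_def h_def)
        have "\<exists>r\<in>nb V u. b r = -1"
          using no_link_at_low[OF u(1) one(1) _ v deg] b0 by fastforce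
        then obtain r where r: "r \<in> V" "adj u r" "b r = -1" by (auto simp: nb_def)
        have "-10 \<le> (\<Sum>x\<in>{u, r}. charge x)"
          using r u by (intro sum_charge_ge) (auto simp: links_def)
        moreover have "u \<noteq> r" using r adj_irrefl by auto
        ultimately have "-10 \<le> charge u + charge r" by simp
        then show False using charge_forced[OF r(1,3)] one b0 kh by simp
      qed
      then have "k = 0" by (simp add: k_def)
      then show ?thesis using one b0 kh by simp
    next
      case False
      have "1 \<le> b u" using False one by linarith
      moreover have "h \<le> 2" using one s kh by linarith
      ultimately have "b u = 1" "h = 2" using kh by linarith+
      moreover have "k = 1" using calculation one s kh by linarith
      ultimately have "b u = 1" "h = 2" "k = 1" by auto
      then show ?thesis using one by simp
    qed
  qed (use s kh in linarith)+
  then show "a u = 1" "card (link_nb u) \<le> 1" "charge u \<le> -6" by (auto simp: k_def)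
qed

lemma contradiction: False
proof -
  define U where "U = {u \<in> V - links. b u < int (card (core_nb u))}"
  have U: "u \<in> V" "u \<notin> links" "a u = 1" "card (link_nb u) \<le> 1" "charge u \<le> -6" if "u \<in> U" for u
    using that excess_vertex[of u] by (auto simp: U_def)
  \<comment> \<open>Two such vertices would have total charge at most -12.\<close>
  have single: "u = u'" if "u \<in> U" "u' \<in> U" for u u'
  proof (rule ccontr)
    assume "u \<noteq> u'"
    moreover have "-10 \<le> (\<Sum>x\<in>{u, u'}. charge x)"
      using U(1,2) that by (intro sum_charge_ge) auto
    ultimately show False using U(5)[OF that(1)] U(5)[OF that(2)] by simp
  qed
  define \<chi> where "\<chi> x = (x \<in> links \<or> x \<in> U)" for x
  have "cdeg V \<chi> x \<le> cap a b (\<chi> x) x" if "x \<in> V" for x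
  proof -
    define Y where "Y = {r \<in> nb V x. \<chi> r = \<chi> x}"
    consider "x \<in> links" | "x \<in> U" | "x \<notin> links" "x \<notin> U" by blast
    then show ?thesis
    proof cases
      case 1
      have "Y \<subseteq> U" using 1 links_indep[OF 1] by (auto simp: Y_def \<chi>_def nb_def)
      moreover have "finite U" using finV by (simp add: U_def)
      ultimately have "card Y \<le> card U" by (rule card_mono[rotated])
      also have "\<dots> \<le> 1" using single \<open>finite U\<close> by (metis One_nat_def card_le_Suc0_iff_eq)
      finally show ?thesis using 1 by (simp add: Y_def cdeg_def cap_def \<chi>_def links_def)
    next
      case 2
      have "Y \<subseteq> link_nb x"
      proof
        fix r assume "r \<in> Y"
        then have r: "r \<in> nb V x" "r \<in> links \<or> r \<in> U" using 2 by (auto simp: Y_def \<chi>_def)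
        then have "r \<notin> U" using single[OF 2] adj_irrefl by (metis mem_Collect_eq nb_def)
        then show "r \<in> link_nb x" using r by (simp add: link_nb_def nb_def)
      qed
      then have "card Y \<le> card (link_nb x)" using nb_V_split(3) by (intro card_mono) auto
      then have "card Y \<le> 1" using U(4)[OF 2] by simp
      moreover have "\<chi> x" using 2 by (simp add: \<chi>_def)
      ultimately show ?thesis using U(3)[OF 2] by (simp add: Y_def cdeg_def cap_def)
    next
      case 3
      then have nx: "\<not> \<chi> x" by (simp add: \<chi>_def)
      have "Y \<subseteq> core_nb x"
        using 3 by (auto simp: Y_def \<chi>_def core_nb_def)
      then have "card Y \<le> card (core_nb x)" using nb_V_split(4) by (intro card_mono) auto
      moreover have "int (card (core_nb x)) \<le> b x" using 3 that by (simp add: U_def)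
      ultimately show ?thesis using nx by (simp add: Y_def cdeg_def cap_def)
    qed
  qed
  then show False using not_col by (auto simp: col_def valid_def)
qed

end

context adjacency
begin

text \<open>\<open>W\<close> itself is uncolourable, which lets criticality identify it with the
  whole graph. For constant capacities 1 and 3 the first alternative cannot occur, as it requires a
  vertex with \<open>b v = -1\<close>.\<close>

lemma low_subset:
  assumes "finite V" "bounded_caps a b V" "\<not> col a b V"
  shows "overfull a b V \<or> (\<exists>W\<subseteq>V. \<not> col a b W \<and> pot a b W \<le> -6)"
  using assms
proof (induction "card V" arbitrary: V a b rule: less_induct)
  case less
  show ?case
  proof (rule ccontr)
    assume no: "\<not> ?thesis"
    have "min_counterexample adj V a b"
    proof unfold_locales
      show "-5 \<le> pot a b W" if "W \<subseteq> V" "\<not> col a b W" for W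
      proof (rule ccontr)
        assume "\<not> ?thesis"
        then have "pot a b W \<le> -6" by linarith
        then show False using no that by blast
      qed
      show "overfull a' b' T \<or> (\<exists>W\<subseteq>T. \<not> col a' b' W \<and> pot a' b' W \<le> -6)"
        if "finite T" "card T < card V" "bounded_caps a' b' T" "\<not> col a' b' T" for T a' b'
        by (rule less.hyps) (use that in auto)
      show "\<not> overfull a b V" using no by blast
    qed (use less.prems in auto)
    then show False by (rule min_counterexample.contradiction)
  qed
qed

end

section \<open>Critical graphs\<close>

definition adjacent :: "'a graph \<Rightarrow> 'a \<Rightarrow> 'a \<Rightarrow> bool" where
  "adjacent G x y \<longleftrightarrow> {x, y} \<in> edges G"

lemma adjacency_adjacent:
  assumes "simple_graph G" shows "adjacency (adjacent G)"
proof
  show "\<not> adjacent G x x" for x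
    using assms by (force simp: simple_graph_def adjacent_def)
qed (simp add: adjacent_def insert_commute)

lemma induced_induced_subgraph:
  "S \<subseteq> W \<Longrightarrow> induced_subgraph (induced_subgraph G W) S = induced_subgraph G S"
  unfolding induced_subgraph_def by auto

lemma edges_induced_subgraph:
  assumes "simple_graph G"
  shows "edges (induced_subgraph G S) = adjacency.edges_in (adjacent G) S"
proof -
  have "\<exists>x y. e = {x, y}" if "e \<in> edges G" for e
  proof -
    have "card e = 2" using assms that by (simp add: simple_graph_def)
    then show ?thesis by (auto simp: card_2_iff)
  qed
  then show ?thesis
    unfolding adjacency.edges_in_def[OF adjacency_adjacent[OF assms]] induced_subgraph_def adjacent_def
    by fastforce
qed

lemma degree_induced_subgraph:
  assumes "simple_graph G" "v \<in> S"
  shows "degree (induced_subgraph G S) v = card (adjacency.nb (adjacent G) S v)"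
proof -
  interpret adjacency "adjacent G" by (rule adjacency_adjacent[OF assms(1)])
  have "{e \<in> edges (induced_subgraph G S). v \<in> e} = (\<lambda>r. {v, r}) ` nb S v"
    unfolding edges_induced_subgraph[OF assms(1)] using assms(2)
    by (auto simp: edges_in_def nb_def insert_commute dest: adj_sym)
  moreover have "inj_on (\<lambda>r. {v, r}) (nb S v)"
    by (auto simp: inj_on_def doubleton_eq_iff)
  ultimately show ?thesis by (simp add: degree_def card_image)
qed

lemma colorable_iff_col:
  assumes "simple_graph G"
  shows "colorable i j (induced_subgraph G W) \<longleftrightarrow> adjacency.col (adjacent G) (\<lambda>_. int i) (\<lambda>_. int j) W"
proof -
  interpret adjacency "adjacent G" by (rule adjacency_adjacent[OF assms])
  have deg: "degree (induced_subgraph (induced_subgraph G W) S) v = card (nb S v)" if "S \<subseteq> W" "v \<in> S" for S v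
    using degree_induced_subgraph[OF assms that(2)] induced_induced_subgraph[OF that(1)] by metis
  show ?thesis
  proof
    assume "colorable i j (induced_subgraph G W)"
    then obtain V1 V2 where V: "V1 \<union> V2 = W" "V1 \<inter> V2 = {}"
      and d: "\<And>v. v \<in> V1 \<Longrightarrow> card (nb V1 v) \<le> i" "\<And>v. v \<in> V2 \<Longrightarrow> card (nb V2 v) \<le> j"
      unfolding colorable_def using deg by (fastforce simp: induced_subgraph_def)
    have "{r \<in> nb W v. (r \<in> V1) = (v \<in> V1)} = (if v \<in> V1 then nb V1 v else nb V2 v)" for v
      using V by (auto simp: nb_def)
    then have "valid (\<lambda>_. int i) (\<lambda>_. int j) W (\<lambda>v. v \<in> V1)"
      using d V by (auto simp: valid_def cdeg_def cap_def)
    then show "col (\<lambda>_. int i) (\<lambda>_. int j) W" by (auto simp: col_def)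
  next
    assume "col (\<lambda>_. int i) (\<lambda>_. int j) W"
    then obtain \<phi> where \<phi>: "\<And>v. v \<in> W \<Longrightarrow> cdeg W \<phi> v \<le> cap (\<lambda>_. int i) (\<lambda>_. int j) (\<phi> v) v"
      by (auto simp: col_def valid_def)
    define S where "S c = {v \<in> W. \<phi> v = c}" for c
    have "card (nb (S c) v) \<le> (if c then i else j)" if "v \<in> S c" for v c
    proof -
      have "{r \<in> nb W v. \<phi> r = \<phi> v} = nb (S c) v"
        using that by (auto simp: nb_def S_def)
      then show ?thesis
        using \<phi>[of v] that by (auto simp: S_def cdeg_def cap_def)
    qed
    from this[of _ True] this[of _ False]
    have "\<forall>v\<in>S True. card (nb (S True) v) \<le> i" "\<forall>v\<in>S False. card (nb (S False) v) \<le> j"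
      by auto
    moreover have "S c \<subseteq> W" for c by (auto simp: S_def)
    moreover have "S True \<union> S False = W" "S True \<inter> S False = {}" by (auto simp: S_def)
    moreover have "verts (induced_subgraph G W) = W" by (simp add: induced_subgraph_def)
    ultimately show "colorable i j (induced_subgraph G W)"
      unfolding colorable_def by (intro exI[of _ "S True"] exI[of _ "S False"]) (simp add: deg)
  qed
qed

theorem theorem2:
  fixes G :: "'a graph"
  assumes "simple_graph G"
    and "critical 1 3 G"
  shows "14 * int (card (verts G)) - 9 * int (card (edges G)) \<le> -6"
proof -
  interpret adjacency "adjacent G" by (rule adjacency_adjacent[OF assms(1)])
  define a b :: "'a \<Rightarrow> int" where "a = (\<lambda>_. 1)" and "b = (\<lambda>_. 3)"
  have col: "colorable 1 3 (induced_subgraph G W) \<longleftrightarrow> col a b W" for W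
    using colorable_iff_col[OF assms(1), of 1 3] by (simp add: a_def b_def)
  have self: "induced_subgraph G (verts G) = G"
    using assms(1) by (auto simp: simple_graph_def induced_subgraph_def prod_eq_iff)
  have "\<not> col a b (verts G)"
    using assms(2) col[of "verts G"] unfolding self by (simp add: critical_def)
  moreover have "finite (verts G)" using assms(1) by (simp add: simple_graph_def)
  moreover have "bounded_caps a b (verts G)" "\<not> overfull a b (verts G)"
    by (auto simp: bounded_caps_def overfull_def a_def b_def)
  ultimately obtain W where W: "W \<subseteq> verts G" "\<not> col a b W" "pot a b W \<le> -6"
    using low_subset[of "verts G" a b] by metis
  have "finite W" using assms(1) W(1) finite_subset by (auto simp: simple_graph_def)
  then have "subgraph (induced_subgraph G W) G"
    using assms(1) W(1) by (simp add: subgraph_def simple_graph_def induced_subgraph_def)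
  moreover have "\<not> colorable 1 3 (induced_subgraph G W)" using W(2) col by simp
  ultimately have G: "induced_subgraph G W = G"
    using assms(2) unfolding critical_def proper_subgraph_def by metis
  have "edges G = edges_in W"
    using edges_induced_subgraph[OF assms(1), of W] unfolding G .
  moreover have "verts G = W"
    using arg_cong[OF G, of fst] by (simp add: induced_subgraph_def)
  ultimately show ?thesis using W(3) by (simp add: pot_def a_def b_def wt_def)
qed

end
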